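(* Let $d\ge 2$ and let $F:\mathbb{N}^d\to\mathbb{C}$ be a multiplicative arithmetic function such that for each $i=1,\ldots,d$ there are only finitely many primes $p$ with $F(1,\ldots,1,p,1,\ldots,1)\in(-\infty,0]$ ($p$ in the $i$-th position), and such that for all $i=1,\ldots,d$ and every $A>0$, $$\sum_{p\in\mathcal{P}}\frac{1}{p}\mathbf{1}_{\{|F_i(p)|>A\}}<\infty\quad\text{and}\quad \sum_{p\in\mathcal{P}}\frac{1}{p}|F_i(p)|\mathbf{1}_{\{|F_i(p)|\le A\}}<\infty .$$ Let $(\mathcal{D}_n)_{n\in\mathbb{N}}$ be a sequence of finite, non-empty subsets of $\mathbb{N}^d$ such that: (1) for every fixed $c\in\mathbb{Z}^d$, $\displaystyle\lim_{n\to\infty}\frac{\#((\mathcal{D}_n+c)\cap \mathcal{D}_n)}{\#\mathcal{D}_n}=1$; (2) there exists $K>0$ such that for all $i,j\in\{1,\ldots,d\}$ with $i\ne j$, all $a,b\in\mathbb{N}$ and all $n\in\mathbb{N}$, $\displaystyle\frac{\#(\mathcal{D}_n\cap \mathbb{Z}_i(a)\cap \mathbb{Z}_j(b))}{\#\mathcal{D}_n}\le\frac{K}{ab}$. For each $n\in\mathbb{N}$, let $(X_1^{(n)},\ldots,X_d^{(n)})$ be a random vector with the uniform distribution on $\mathcal{D}_n$. Then, as $n\to\infty$, in distribution, $$F(X_1^{(n)},\ldots,X_d^{(n)})\ \longrightarrow\ \prod_{p\in\mathcal{P}}F(p^{\mathcal{G}_1(p)},\ldots,p^{\mathcal{G}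_d(p)}).$$
   Context: $\mathbb{N}=\{1,2,3,\ldots\}$, $\mathbb{N}_0=\mathbb{N}\cup\{0\}$, $\mathcal{P}$ is the set of primes, $\#$ denotes cardinality. A function $F:\mathbb{N}^d\to\mathbb{C}$ is multiplicative if $F(1,\ldots,1)=1$ and $F(m_1n_1,\ldots,m_dn_d)=F(m_1,\ldots,m_d)F(n_1,\ldots,n_d)$ for all $(m_1,\ldots,m_d),(n_1,\ldots,n_d)\in\mathbb{N}^d$ with $\gcd(m_1\cdots m_d,n_1\cdots n_d)=1$. For $i=1,\ldots,d$, $F_i(x):=\log F(1,\ldots,1,x,1,\ldots,1)$ with $x\in\mathbb{N}$ in the $i$-th position, where $\log$ is the principal branch of the logarithm ($\log 1=0$, branch cut along $(-\infty,0]$); in the sums over $p$, the finitely many primes $p$ for which $F_i(p)$ is not defined because the argument lies on the branch cut are omitted. For $i=1,\ldots,d$ and $a\in\mathbb{N}$, $\mathbb{Z}_i(a):=\{(x_1,\ldots,x_d)\in\mathbb{Z}^d: x_i\text{ is divisible by }a\}$. $(\mathcal{G}_1(p),\ldots,\mathcal{G}_d(p))_{p\in\mathcal{P}}$ is an array of mutually independent random variables with $\mathbb{P}\{\mathcal{G}_k(p)\ge j\}=p^{-j}$ for $j\in\mathbb{N}_0$, $p\in\mathcal{P}$, $k=1,\ldots,d$. The infinite product over primes is the almost sure limit, as $M\to\infty$, of the partial products over primes $p\le M$. *)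

theory Defs
  imports "HOL-Probability.Probability" "HOL-Computational_Algebra.Primes"
begin

text \<open>
  Arithmetic functions of \<open>d\<close> variables are functions on \<^typ>\<open>nat ^ 'd\<close>; since the
  positive integers are meant, only values on \<open>pos_vecs\<close> are ever constrained or used.
  Products and the constant \<open>1\<close> on vectors are componentwise.
\<close>

definition pos_vecs :: "(nat ^ 'd::finite) set" where
  "pos_vecs = {x. \<forall>i. 0 < x $ i}"

definition multiplicative_vec :: "(nat ^ 'd::finite \<Rightarrow> complex) \<Rightarrow> bool" where
  "multiplicative_vec F \<longleftrightarrow> F 1 = 1 \<and>
     (\<forall>m\<in>pos_vecs. \<forall>n\<in>pos_vecs.
        coprime (\<Prod>i\<in>UNIV. m $ i) (\<Prod>i\<in>UNIV. n $ i) \<longrightarrow> F (m * n) = F m * F n)"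

definition single_coord :: "'d::finite \<Rightarrow> nat \<Rightarrow> nat ^ 'd" where
  "single_coord i x = (\<chi> j. if j = i then x else 1)"

text \<open>
  \<^const>\<open>Ln\<close> is the principal branch off \<^term>\<open>\<real>\<^sub>\<le>\<^sub>0 :: complex set\<close>. On the cut it
  still takes some value, so sums involving \<open>log_coord\<close> range over \<open>log_primes\<close> only.
\<close>

definition log_coord :: "(nat ^ 'd::finite \<Rightarrow> complex) \<Rightarrow> 'd \<Rightarrow> nat \<Rightarrow> complex" where
  "log_coord F i x = Ln (F (single_coord i x))"

definition log_primes :: "(nat ^ 'd::finite \<Rightarrow> complex) \<Rightarrow> 'd \<Rightarrow> nat set" where
  "log_primes F i = {p. prime p \<and> F (single_coord i p) \<notin> \<real>\<^sub>\<le>\<^sub>0}"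

definition int_vec :: "nat ^ 'd::finite \<Rightarrow> int ^ 'd" where
  "int_vec x = (\<chi> i. int (x $ i))"

definition coord_multiples :: "'d::finite \<Rightarrow> nat \<Rightarrow> (int ^ 'd) set" where
  "coord_multiples i a = {x. int a dvd x $ i}"

text \<open>
  \<open>weak_conv_m\<close> from the library covers laws on the real line only (through distribution
  functions). For complex random variables, convergence in distribution is weak convergence of
  the laws, tested on bounded continuous functions. The \<open>X n\<close> may live on different spaces.
\<close>

definition converges_in_distribution ::
  "(nat \<Rightarrow> 'a measure) \<Rightarrow> (nat \<Rightarrow> 'a \<Rightarrow> 'c::topological_space) \<Rightarrow> 'b measure \<Rightarrow> ('b \<Rightarrow> 'c) \<Rightarrow> bool"
  where
  "converges_in_distribution P X M Y \<longleftrightarrow>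
     (\<forall>n. X n \<in> borel_measurable (P n)) \<and> Y \<in> borel_measurable M \<and>
     (\<forall>f :: 'c \<Rightarrow> real. continuous_on UNIV f \<and> bounded (range f) \<longrightarrow>
        (\<lambda>n. \<integral>\<omega>. f (X n \<omega>) \<partial>P n) \<longlonglongrightarrow> (\<integral>\<omega>. f (Y \<omega>) \<partial>M))"

definition partial_euler_product ::
  "(nat ^ 'd::finite \<Rightarrow> complex) \<Rightarrow> ('d \<Rightarrow> nat \<Rightarrow> 'w \<Rightarrow> nat) \<Rightarrow> nat \<Rightarrow> 'w \<Rightarrow> complex" where
  "partial_euler_product F G N \<omega> = (\<Prod>p | prime p \<and> p \<le> N. F (\<chi> i. p ^ G i p \<omega>))"

end

theory Submission
  imports Defs
begin

text \<open>
  By multiplicativity, \<open>F x\<close> is the product over primes \<open>p\<close> of the values of \<open>F\<close> at the vector of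
  the \<open>p\<close>-parts of the coordinates of \<open>x\<close>. The exponents of a fixed finite set of primes are
  asymptotically independent and geometric under the uniform law on \<open>D n\<close>; the point is to show that
  the remaining primes are negligible, uniformly in \<open>n\<close>.

  Small primes. Asymptotic translation invariance makes all residue classes modulo a given vector
  equally likely in the limit (\<open>divisibility_density\<close>), which determines the limits of the joint tails
  of the exponents. Tails determine point masses by successive differences
  (\<open>point_masses_of_joint_tails\<close>), and convergence of point masses to a probability law on a
  countable set gives convergence of all bounded expectations
  (\<open>expectation_tendsto_of_point_masses\<close>). Hence the Euler product truncated at \<open>N\<close> converges to its
  analogue for the geometric variables as \<open>n\<close> tends to infinity (\<open>smooth_part_expectation_tendsto\<close>).

  Large primes. Attach to every prime the cost \<open>prime_cost\<close>, which is at least \<open>1\<close> if the prime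
  occurs squared, occurs in two coordinates, or occurs where the logarithm of \<open>F\<close> is large or
  undefined, and which otherwise bounds the norm of the logarithm of the factor at this prime. If the
  costs beyond \<open>N\<close> add up to less than \<open>1\<close>, the rest of the Euler product is therefore \<open>exp s\<close>
  with \<open>s\<close> bounded by that sum (\<open>euler_part_tail_eq_exp\<close>). In expectation the cost at \<open>p\<close> is at most
  a constant times \<open>prime_budget F p\<close>, which is summable by the hypotheses on the logarithms
  (\<open>summable_prime_budget\<close>). This needs only a bound for the probability that prescribed powers
  of \<open>p\<close> divide two distinct coordinates, which is available both for the uniform laws, with a
  common constant, and for the geometric variables; \<open>divisibility_bounds\<close> captures this common ground.

  For the geometric variables the total cost is almost surely finite, whence the Euler product converges
  almost surely (\<open>euler_part_convergent\<close>). For the uniform laws Markov's inequality makes the cost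
  beyond \<open>N\<close> small with high probability, uniformly in \<open>n\<close>. As the error is multiplicative, it is
  negligible where the truncated product is bounded, and tightness of the truncated products is read off
  from the almost sure convergence in the limiting model. Both limits are put together in
  \<open>expectation_tendsto_euler_product\<close>.
\<close>

section \<open>Euler products with cheap tails\<close>

text \<open>
  The exponents \<open>e i p\<close> are either multiplicities in the coordinates of a given vector or values of
  geometric variables, so that one deterministic analysis of the product serves both models.
\<close>

definition euler_part ::
  "(nat ^ 'd::finite \<Rightarrow> complex) \<Rightarrow> ('d \<Rightarrow> nat \<Rightarrow> nat) \<Rightarrow> nat \<Rightarrow> complex" where
  "euler_part F e N = (\<Prod>p | prime p \<and> p \<le> N. F (\<chi> i. p ^ e i p))"

text \<open>
  The weight \<open>1\<close> marks the primes at which the logarithm is large or undefined. Divisibility by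
  such a prime is to be avoided altogether rather than estimated.
\<close>

definition log_weight :: "(nat ^ 'd::finite \<Rightarrow> complex) \<Rightarrow> 'd \<Rightarrow> nat \<Rightarrow> real" where
  "log_weight F i p =
     (if p \<in> log_primes F i \<and> norm (log_coord F i p) \<le> 1 then norm (log_coord F i p) else 1)"

text \<open>
  A cost below \<open>1\<close> forces \<open>p\<close> to divide at most one coordinate, with exponent one and with a
  logarithm of norm below \<open>1\<close>; the cost then dominates that logarithm. Being a linear combination of
  indicators, it has an expectation that is controlled by divisibility probabilities alone.
\<close>

definition prime_cost :: "(nat ^ 'd::finite \<Rightarrow> complex) \<Rightarrow> ('d \<Rightarrow> nat \<Rightarrow> nat) \<Rightarrow> nat \<Rightarrow> real" where
  "prime_cost F e p =
     (\<Sum>i\<in>UNIV. of_bool (2 \<le> e i p)) + (\<Sum>i\<in>UNIV. log_weight F i p * of_bool (1 \<le> e i p))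
     + (\<Sum>(i, j) | i \<noteq> j. of_bool (1 \<le> e i p \<and> 1 \<le> e j p))"

text \<open>
  Collecting the exponents at primes up to \<open>N\<close> into a vector of \<open>N\<close>-smooth numbers gives a random
  element of a countable type through which the truncated Euler product factors.
\<close>

definition smooth_vec :: "('d::finite \<Rightarrow> nat \<Rightarrow> nat) \<Rightarrow> nat \<Rightarrow> nat ^ 'd" where
  "smooth_vec e N = (\<chi> i. \<Prod>p | prime p \<and> p \<le> N. p ^ e i p)"

lemma finite_primes_upto [simp]: "finite {p::nat. prime p \<and> p \<le> N}"
  by (rule finite_subset[of _ "{..N}"]) auto

lemma multiplicative_vec_prod_prime_powers:
  assumes F: "multiplicative_vec F" and Q: "finite Q" "\<And>p. p \<in> Q \<Longrightarrow> prime p"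
  shows "F (\<chi> i. \<Prod>p\<in>Q. p ^ e i p) = (\<Prod>p\<in>Q. F (\<chi> i. p ^ e i p))"
  using Q
proof (induction Q rule: finite_induct)
  case empty
  have "(\<chi> i. 1) = (1 :: nat ^ 'a)" by (simp add: vec_eq_iff)
  then show ?case using F by (simp add: multiplicative_vec_def)
next
  case (insert q Q)
  let ?m = "\<chi> i. q ^ e i q" and ?n = "\<chi> i. \<Prod>p\<in>Q. p ^ e i p"
  have pos: "?m \<in> pos_vecs" "?n \<in> pos_vecs"
    using insert.prems by (auto simp: pos_vecs_def prime_gt_0_nat intro!: prod_pos)
  have "coprime q p" if "p \<in> Q" for p
    using that insert by (metis insertCI primes_coprime)
  then have "coprime (\<Prod>i\<in>UNIV. ?m $ i) (\<Prod>i\<in>UNIV. ?n $ i)"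
    by (auto intro!: prod_coprime_left prod_coprime_right)
  then have "F (?m * ?n) = F ?m * F ?n"
    using F pos by (simp add: multiplicative_vec_def)
  moreover have "(\<chi> i. \<Prod>p\<in>insert q Q. p ^ e i p) = ?m * ?n"
    using insert by (simp add: vec_eq_iff)
  ultimately show ?case using insert by simp
qed

lemma F_smooth_vec:
  "multiplicative_vec F \<Longrightarrow> F (smooth_vec e N) = euler_part F e N"
  unfolding smooth_vec_def euler_part_def
  by (rule multiplicative_vec_prod_prime_powers) auto

lemma smooth_vec_eq_iff:
  fixes e e' :: "'d::finite \<Rightarrow> nat \<Rightarrow> nat"
  shows "smooth_vec e N = smooth_vec e' N \<longleftrightarrow> (\<forall>i p. prime p \<and> p \<le> N \<longrightarrow> e i p = e' i p)"
proof
  assume eq: "smooth_vec e N = smooth_vec e' N"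
  show "\<forall>i p. prime p \<and> p \<le> N \<longrightarrow> e i p = e' i p"
  proof (intro allI impI)
    fix i :: 'd and p :: nat assume p: "prime p \<and> p \<le> N"
    have *: "multiplicity p (smooth_vec f N $ i) = f i p" for f :: "'d \<Rightarrow> nat \<Rightarrow> nat"
      unfolding smooth_vec_def using p by (simp, subst multiplicity_prod_prime_powers) auto
    show "e i p = e' i p" using *[of e] *[of e'] eq by simp
  qed
qed (auto simp: smooth_vec_def vec_eq_iff intro!: prod.cong)

definition exponents :: "nat ^ 'd::finite \<Rightarrow> 'd \<Rightarrow> nat \<Rightarrow> nat" where
  "exponents x i p = multiplicity p (x $ i)"

lemma smooth_vec_exponents:
  assumes "x \<in> pos_vecs" "\<And>i. x $ i \<le> N"
  shows "smooth_vec (exponents x) N = x"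
proof -
  have "(\<Prod>p | prime p \<and> p \<le> N. p ^ multiplicity p (x $ i)) = x $ i" for i
  proof -
    have x: "x $ i > 0" using assms by (auto simp: pos_vecs_def)
    have "prime_factors (x $ i) \<subseteq> {p. prime p \<and> p \<le> N}"
    proof
      fix p assume "p \<in> prime_factors (x $ i)"
      then have "prime p" "p dvd x $ i" by auto
      moreover have "p \<le> x $ i" using calculation x by (auto intro: dvd_imp_le)
      ultimately show "p \<in> {p. prime p \<and> p \<le> N}" using assms(2)[of i] by simp
    qed
    then have "(\<Prod>p | prime p \<and> p \<le> N. p ^ multiplicity p (x $ i))
        = (\<Prod>p\<in>prime_factors (x $ i). p ^ multiplicity p (x $ i))"
      using x by (intro prod.mono_neutral_right) 
        (auto simp: prime_factors_multiplicity not_dvd_imp_multiplicity_0)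
    then show ?thesis using x prime_factorization_nat[of "x $ i"] by simp
  qed
  then show ?thesis by (simp add: smooth_vec_def exponents_def vec_eq_iff)
qed

lemma le_exponents_iff:
  assumes "x \<in> pos_vecs" "prime p"
  shows "k \<le> exponents x i p \<longleftrightarrow> p ^ k dvd x $ i"
proof -
  have "x $ i \<noteq> 0" "\<not> is_unit p" using assms by (auto simp: pos_vecs_def)
  then show ?thesis by (simp add: exponents_def power_dvd_iff_le_multiplicity)
qed

lemma log_weight_nonneg: "0 \<le> log_weight F i p"
  by (simp add: log_weight_def)

lemma prime_cost_nonneg: "0 \<le> prime_cost F e p"
  unfolding prime_cost_def
  by (intro add_nonneg_nonneg sum_nonneg) (auto simp: log_weight_nonneg)

lemma prime_cost_ge:
  "of_bool (2 \<le> e i p) \<le> prime_cost F e p"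
  "log_weight F i p * of_bool (1 \<le> e i p) \<le> prime_cost F e p"
  "i \<noteq> j \<Longrightarrow> of_bool (1 \<le> e i p \<and> 1 \<le> e j p) \<le> prime_cost F e p"
proof -
  let ?A = "\<Sum>i\<in>UNIV. of_bool (2 \<le> e i p) :: real"
  let ?B = "\<Sum>i\<in>UNIV. log_weight F i p * of_bool (1 \<le> e i p)"
  let ?C = "\<Sum>(i, j) | i \<noteq> j. of_bool (1 \<le> e i p \<and> 1 \<le> e j p) :: real"
  have nn: "0 \<le> ?A" "0 \<le> ?B" "0 \<le> ?C" by (auto intro!: sum_nonneg simp: log_weight_nonneg)
  have "of_bool (2 \<le> e i p) \<le> ?A" by (rule member_le_sum) auto
  then show "of_bool (2 \<le> e i p) \<le> prime_cost F e p"
    using nn unfolding prime_cost_def by linarith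
  have "log_weight F i p * of_bool (1 \<le> e i p) \<le> ?B"
    by (rule member_le_sum[where f = "\<lambda>i. log_weight F i p * of_bool (1 \<le> e i p)"])
      (auto simp: log_weight_nonneg)
  then show "log_weight F i p * of_bool (1 \<le> e i p) \<le> prime_cost F e p"
    using nn unfolding prime_cost_def by linarith
  assume "i \<noteq> j"
  then have "of_bool (1 \<le> e i p \<and> 1 \<le> e j p) \<le> ?C"
    using member_le_sum[of "(i, j)" "{(i, j). i \<noteq> j}"
        "\<lambda>(i, j). of_bool (1 \<le> e i p \<and> 1 \<le> e j p) :: real"] by auto
  then show "of_bool (1 \<le> e i p \<and> 1 \<le> e j p) \<le> prime_cost F e p"
    using nn unfolding prime_cost_def by linarith
qed

text \<open>
  If \<open>p\<close> divides no coordinate, the factor is \<open>F 1 = 1\<close> and \<open>s = 0\<close>; otherwise low cost leaves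
  a single coordinate with exponent one, and \<open>s\<close> is the logarithm there.
\<close>

lemma cheap_factor_eq_exp:
  assumes F: "multiplicative_vec F" and cheap: "prime_cost F e p < 1"
  shows "\<exists>s. F (\<chi> i. p ^ e i p) = exp s \<and> norm s \<le> prime_cost F e p"
proof (cases "\<exists>i. e i p \<noteq> 0")
  case False
  then have "(\<chi> i. p ^ e i p) = 1" by (simp add: vec_eq_iff)
  then show ?thesis using F prime_cost_nonneg[of F e p] 
    by (intro exI[of _ 0]) (simp add: multiplicative_vec_def)
next
  case True
  then obtain i where i: "e i p \<noteq> 0" by blast
  have "e i p < 2" using prime_cost_ge(1)[of e i p F] cheap by (auto split: if_splits simp: of_bool_def)
  then have ei: "e i p = 1" using i by linarith
  have ej: "e j p = 0" if "j \<noteq> i" for j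
    using prime_cost_ge(3)[of i j e p F] cheap ei that by (auto split: if_splits simp: of_bool_def)
  have vec: "(\<chi> i. p ^ e i p) = single_coord i p"
    using ei ej by (auto simp: vec_eq_iff single_coord_def)
  have w: "log_weight F i p \<le> prime_cost F e p"
    using prime_cost_ge(2)[of F i p e] ei by simp
  then have p: "p \<in> log_primes F i \<and> log_weight F i p = norm (log_coord F i p)"
    using cheap by (auto simp: log_weight_def split: if_splits)
  then have "F (single_coord i p) \<noteq> 0" by (auto simp: log_primes_def)
  then have "F (single_coord i p) = exp (log_coord F i p)"
    by (simp add: log_coord_def)
  then show ?thesis using vec w p by auto
qed

text \<open>
  The deterministic heart of the argument: since the tail enters multiplicatively as an exponential of
  something small, truncating the Euler product is harmless wherever the truncated product is bounded,
  even where it vanishes.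
\<close>

lemma euler_part_tail_eq_exp:
  assumes F: "multiplicative_vec F" and "N \<le> L"
    and Q: "(\<Sum>p | prime p \<and> N < p \<and> p \<le> L. prime_cost F e p) \<le> \<delta>" "\<delta> < 1"
  shows "\<exists>s. euler_part F e L = euler_part F e N * exp s \<and> norm s \<le> \<delta>"
proof -
  let ?Q = "{p. prime p \<and> N < p \<and> p \<le> L}"
  have fin: "finite ?Q" by (rule finite_subset[of _ "{..L}"]) auto
  have "prime_cost F e p < 1" if "p \<in> ?Q" for p
    using member_le_sum[OF that, of "prime_cost F e"] fin Q prime_cost_nonneg[of F e] by force
  then have "\<forall>p\<in>?Q. \<exists>s. F (\<chi> i. p ^ e i p) = exp s \<and> norm s \<le> prime_cost F e p"
    using cheap_factor_eq_exp[OF F] by blast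
  then obtain s where s: "\<And>p. p \<in> ?Q \<Longrightarrow> F (\<chi> i. p ^ e i p) = exp (s p) \<and> norm (s p) \<le> prime_cost F e p"
    by metis
  have "{p. prime p \<and> p \<le> L} = {p. prime p \<and> p \<le> N} \<union> ?Q" using \<open>N \<le> L\<close> by auto
  then have "euler_part F e L = euler_part F e N * (\<Prod>p\<in>?Q. F (\<chi> i. p ^ e i p))"
    unfolding euler_part_def using fin by (subst prod.union_disjoint[symmetric]) auto
  also have "(\<Prod>p\<in>?Q. F (\<chi> i. p ^ e i p)) = exp (\<Sum>p\<in>?Q. s p)"
    using fin s by (simp add: exp_sum)
  finally have "euler_part F e L = euler_part F e N * exp (\<Sum>p\<in>?Q. s p)" .
  moreover have "norm (\<Sum>p\<in>?Q. s p) \<le> (\<Sum>p\<in>?Q. prime_cost F e p)"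
    using s by (intro sum_norm_le) auto
  ultimately show ?thesis using Q by (intro exI[of _ "\<Sum>p\<in>?Q. s p"]) auto
qed

section \<open>Expected costs\<close>

text \<open>
  The expectation of the cost up to a constant factor, when divisibility by \<open>p\<close> has probability of
  order \<open>1 / p\<close> per coordinate and divisibility by \<open>p\<^sup>2\<close>, or by \<open>p\<close> in two coordinates, has
  probability of order \<open>1 / p\<^sup>2\<close>.
\<close>

definition prime_budget :: "(nat ^ 'd::finite \<Rightarrow> complex) \<Rightarrow> nat \<Rightarrow> real" where
  "prime_budget F p = (\<Sum>i\<in>(UNIV :: 'd set). 1 / real p ^ 2)
     + (\<Sum>i\<in>UNIV. log_weight F i p * (1 / real p))
     + (\<Sum>(i, j) | i \<noteq> (j :: 'd). 1 / real p ^ 2)"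

text \<open>
  On \<open>log_primes F i\<close> the weight is the sum of the two truncated terms at level \<open>1\<close>, and only
  finitely many primes lie outside this set.
\<close>

lemma summable_prime_budget:
  fixes F :: "nat ^ 'd::finite \<Rightarrow> complex"
  assumes cut: "\<And>i. finite {p. prime p \<and> F (single_coord i p) \<in> \<real>\<^sub>\<le>\<^sub>0}"
    and big: "\<And>i. (\<lambda>p. 1 / real p * of_bool (norm (log_coord F i p) > 1)) summable_on log_primes F i"
    and small: "\<And>i. (\<lambda>p. 1 / real p * norm (log_coord F i p) * of_bool (norm (log_coord F i p) \<le> 1))
        summable_on log_primes F i"
  shows "summable (\<lambda>p. of_bool (prime p) * prime_budget F p)"
proof -
  have sq: "summable (\<lambda>p. of_bool (prime p) * (1 / real p ^ 2))"
    by (rule summable_comparison_test'[OF inverse_power_summable[of 2, where 'a = real]])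
      (auto simp: inverse_eq_divide)
  have w: "summable (\<lambda>p. of_bool (prime p) * (log_weight F i p * (1 / real p)))" for i
  proof -
    let ?g = "\<lambda>p. log_weight F i p * (1 / real p)"
    have "?g p = 1 / real p * of_bool (norm (log_coord F i p) > 1) +
      1 / real p * norm (log_coord F i p) * of_bool (norm (log_coord F i p) \<le> 1)"
      if "p \<in> log_primes F i" for p
      using that by (simp add: log_weight_def)
    then have "?g summable_on log_primes F i"
      using summable_on_add[OF big[of i] small[of i]] by (simp cong: summable_on_cong)
    moreover have "?g summable_on {p. prime p \<and> F (single_coord i p) \<in> \<real>\<^sub>\<le>\<^sub>0}"
      using cut by (rule summable_on_finite)
    ultimately have "?g summable_on (log_primes F i \<union> {p. prime p \<and> F (single_coord i p) \<in> \<real>\<^sub>\<le>\<^sub>0})"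
      by (rule summable_on_Un_disjoint) (auto simp: log_primes_def)
    also have "log_primes F i \<union> {p. prime p \<and> F (single_coord i p) \<in> \<real>\<^sub>\<le>\<^sub>0} = {p. prime p}"
      by (auto simp: log_primes_def)
    also have "?g summable_on {p. prime p} \<longleftrightarrow> (\<lambda>p. of_bool (prime p) * ?g p) summable_on UNIV"
      by (rule summable_on_cong_neutral) auto
    finally show ?thesis by (rule summable_on_imp_summable)
  qed
  have "(\<lambda>p. of_bool (prime p) * prime_budget F p) = (\<lambda>p.
      (\<Sum>i\<in>(UNIV :: 'd set). of_bool (prime p) * (1 / real p ^ 2))
     + (\<Sum>i\<in>UNIV. of_bool (prime p) * (log_weight F i p * (1 / real p)))
     + (\<Sum>(i, j) | i \<noteq> (j :: 'd). of_bool (prime p) * (1 / real p ^ 2)))"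
    by (simp only: prime_budget_def distrib_left sum_distrib_left split_def)
  then show ?thesis
    unfolding split_def by (simp only:) (intro summable_add summable_sum sq w)
qed

text \<open>
  The exponents at composite numbers are arbitrary functions; \<open>smooth_vec\<close> ignores them, so
  measurability at primes suffices.
\<close>

lemma smooth_vec_measurable:
  fixes e :: "'v \<Rightarrow> 'd::finite \<Rightarrow> nat \<Rightarrow> nat"
  assumes e: "\<And>i p. prime p \<Longrightarrow> (\<lambda>\<omega>. e \<omega> i p) \<in> measurable \<mu> (count_space UNIV)"
  shows "(\<lambda>\<omega>. smooth_vec (e \<omega>) N) \<in> measurable \<mu> (count_space UNIV)"
proof (subst measurable_count_space_eq_countable, safe)
  fix v
  show "(\<lambda>\<omega>. smooth_vec (e \<omega>) N) -` {v} \<inter> space \<mu> \<in> sets \<mu>"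
  proof (cases "\<exists>k. v = smooth_vec k N")
    case True
    then obtain k where v: "v = smooth_vec k N" by blast
    have "(\<lambda>\<omega>. smooth_vec (e \<omega>) N) -` {v} \<inter> space \<mu>
        = {\<omega> \<in> space \<mu>. \<forall>t\<in>UNIV \<times> {p. prime p \<and> p \<le> N}. e \<omega> (fst t) (snd t) = k (fst t) (snd t)}"
      unfolding v by (auto simp: smooth_vec_eq_iff)
    also have "\<dots> \<in> sets \<mu>"
    proof (rule sets.sets_Collect_finite_All)
      fix t :: "'d \<times> nat" assume "t \<in> UNIV \<times> {p. prime p \<and> p \<le> N}"
      then show "{\<omega> \<in> space \<mu>. e \<omega> (fst t) (snd t) = k (fst t) (snd t)} \<in> sets \<mu>"
        using measurable_sets[OF e, of "snd t" "{k (fst t) (snd t)}" "fst t"]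
        by (auto simp: vimage_def Int_def conj_commute)
    qed auto
    finally show ?thesis .
  next
    case False
    then have "(\<lambda>\<omega>. smooth_vec (e \<omega>) N) -` {v} \<inter> space \<mu> = {}" by blast
    then show ?thesis by simp
  qed
qed auto

text \<open>x\<close>
text \<open>
  The only probabilistic input for the tail of the Euler product is the pair bound. It holds for the
  uniform law on each of the sets, with a constant common to all of them, and for independent geometric
  exponents, so the tail estimates below are shared. With at least two coordinates, taking \<open>b = 0\<close>
  turns the pair bound into a bound for a single coordinate.
\<close>

locale divisibility_bounds = prob_space \<mu> for \<mu> :: "'v measure" +
  fixes e :: "'v \<Rightarrow> 'd::finite \<Rightarrow> nat \<Rightarrow> nat" and K :: real
  assumes two_coords: "2 \<le> CARD('d)" and K_pos: "0 < K"
    and measurable_exponent: "prime p \<Longrightarrow> (\<lambda>\<omega>. e \<omega> i p) \<in> measurable \<mu> (count_space UNIV)"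
    and pair_bound: "\<lbrakk>prime p; i \<noteq> j\<rbrakk> \<Longrightarrow>
      measure \<mu> {\<omega> \<in> space \<mu>. a \<le> e \<omega> i p \<and> b \<le> e \<omega> j p} \<le> K / (real (p ^ a) * real (p ^ b))"
begin

lemma single_bound:
  assumes "prime p"
  shows "prob {\<omega> \<in> space \<mu>. a \<le> e \<omega> i p} \<le> K / real p ^ a"
proof -
  have "\<exists>j. i \<noteq> j"
  proof (rule ccontr)
    assume "\<not> ?thesis"
    then have "(UNIV :: 'd set) = {i}" by auto
    then have "CARD('d) = 1" by (metis card_1_singleton_iff One_nat_def)
    then show False using two_coords by simp
  qed
  then obtain j where "i \<noteq> j" by blast
  then show ?thesis using pair_bound[OF assms, of i j a 0] by simp
qed

lemma prime_cost_expectation: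
  assumes p: "prime p"
  shows "integrable \<mu> (\<lambda>\<omega>. prime_cost F (e \<omega>) p)"
    and "expectation (\<lambda>\<omega>. prime_cost F (e \<omega>) p) \<le> K * prime_budget F p"
proof -
  have pred1: "{\<omega> \<in> space \<mu>. a \<le> e \<omega> i p} \<in> events" for a i
    using measurable_sets[OF measurable_exponent[OF p], of "{a..}" i] by (simp add: vimage_def Int_def conj_commute)
  have pred2: "{\<omega> \<in> space \<mu>. a \<le> e \<omega> i p \<and> b \<le> e \<omega> j p} \<in> events" for a b i j
    using sets.Int[OF pred1[of a i] pred1[of b j]] by (simp add: Int_def conj_ac cong: conj_cong)
  have ob: "integrable \<mu> (\<lambda>\<omega>. of_bool (Q \<omega>) :: real) \<and>
      expectation (\<lambda>\<omega>. of_bool (Q \<omega>)) = prob {\<omega> \<in> space \<mu>. Q \<omega>}"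
    if Q: "{\<omega> \<in> space \<mu>. Q \<omega>} \<in> events" for Q
  proof -
    have "integrable \<mu> (indicator {\<omega> \<in> space \<mu>. Q \<omega>} :: _ \<Rightarrow> real)"
      using Q by (simp add: integrable_real_indicator emeasure_eq_measure)
    moreover have "expectation (indicator {\<omega> \<in> space \<mu>. Q \<omega>}) = prob {\<omega> \<in> space \<mu>. Q \<omega>}"
      using Q by (simp add: Int_absorb2 Collect_restrict)
    moreover have "\<omega> \<in> space \<mu> \<Longrightarrow> of_bool (Q \<omega>) = (indicator {\<omega> \<in> space \<mu>. Q \<omega>} \<omega> :: real)" for \<omega>
      by simp
    ultimately show ?thesis
      by (simp cong: Bochner_Integration.integral_cong Bochner_Integration.integrable_cong)
  qed
  note ob1 = ob[OF pred1] and ob2 = ob[OF pred2]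
  show "integrable \<mu> (\<lambda>\<omega>. prime_cost F (e \<omega>) p)"
    unfolding prime_cost_def split_def
    by (intro Bochner_Integration.integrable_add Bochner_Integration.integrable_sum
        integrable_mult_right ob1[THEN conjunct1] ob2[THEN conjunct1])
  have "expectation (\<lambda>\<omega>. prime_cost F (e \<omega>) p)
      = (\<Sum>i\<in>UNIV. prob {\<omega> \<in> space \<mu>. 2 \<le> e \<omega> i p})
      + (\<Sum>i\<in>UNIV. log_weight F i p * prob {\<omega> \<in> space \<mu>. 1 \<le> e \<omega> i p})
      + (\<Sum>(i, j) | i \<noteq> j. prob {\<omega> \<in> space \<mu>. 1 \<le> e \<omega> i p \<and> 1 \<le> e \<omega> j p})"
    unfolding prime_cost_def split_def using ob1 ob2
    by (simp del: sum_of_bool_eq sum_mult_of_bool_eq sum_of_bool_mult_eq of_bool_conj)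
  also have "\<dots> \<le> (\<Sum>i\<in>(UNIV :: 'd set). K * (1 / real p ^ 2))
      + (\<Sum>i\<in>UNIV. log_weight F i p * (K * (1 / real p)))
      + (\<Sum>(i, j) | i \<noteq> (j :: 'd). K * (1 / real p ^ 2))"
    using single_bound[OF p, of 2] single_bound[OF p, of 1] pair_bound[OF p, of _ _ 1 1]
    by (intro add_mono sum_mono mult_left_mono)
      (auto simp: log_weight_nonneg split_def power2_eq_square)
  also have "\<dots> = K * prime_budget F p"
    by (simp add: prime_budget_def distrib_left sum_distrib_left split_def mult_ac)
  finally show "expectation (\<lambda>\<omega>. prime_cost F (e \<omega>) p) \<le> K * prime_budget F p" .
qed

lemma prime_cost_Markov:
  assumes Q: "finite Q" "\<And>p. p \<in> Q \<Longrightarrow> prime p" and "\<delta> > 0"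
  shows "prob {\<omega> \<in> space \<mu>. \<delta> \<le> (\<Sum>p\<in>Q. prime_cost F (e \<omega>) p)} \<le> K * (\<Sum>p\<in>Q. prime_budget F p) / \<delta>"
proof -
  have "prob {\<omega> \<in> space \<mu>. \<delta> \<le> (\<Sum>p\<in>Q. prime_cost F (e \<omega>) p)}
      \<le> expectation (\<lambda>\<omega>. \<Sum>p\<in>Q. prime_cost F (e \<omega>) p) / \<delta>"
    using Q \<open>\<delta> > 0\<close>
    by (intro integral_Markov_inequality_measure[where A = "{}"] Bochner_Integration.integrable_sum prime_cost_expectation)
      (auto intro!: sum_nonneg prime_cost_nonneg)
  also have "expectation (\<lambda>\<omega>. \<Sum>p\<in>Q. prime_cost F (e \<omega>) p) = (\<Sum>p\<in>Q. expectation (\<lambda>\<omega>. prime_cost F (e \<omega>) p))"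
    using Q by (intro Bochner_Integration.integral_sum prime_cost_expectation)
  also have "\<dots> \<le> (\<Sum>p\<in>Q. K * prime_budget F p)"
    using Q by (intro sum_mono prime_cost_expectation)
  finally show ?thesis using \<open>\<delta> > 0\<close> by (simp add: sum_distrib_left divide_right_mono)
qed

text \<open>
  The total cost has finite expectation, hence is finite almost surely. This covers in one stroke what
  the Borel-Cantelli lemma would give for large logarithms, squares and common prime divisors.
\<close>

lemma AE_summable_prime_cost:
  fixes F :: "nat ^ 'd \<Rightarrow> complex"
  assumes budget: "summable (\<lambda>p. of_bool (prime p) * prime_budget F p)"
  shows "AE \<omega> in \<mu>. summable (\<lambda>p. of_bool (prime p) * prime_cost F (e \<omega>) p)"
proof -
  let ?f = "\<lambda>p \<omega>. of_bool (prime p) * prime_cost F (e \<omega>) p"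
  have int: "integrable \<mu> (?f p)" for p
    by (cases "prime p") (auto intro: prime_cost_expectation)
  have nonneg: "0 \<le> ?f p \<omega>" for p \<omega> by (simp add: prime_cost_nonneg)
  have exp: "expectation (?f p) \<le> K * (of_bool (prime p) * prime_budget F p)" for p
    using prime_cost_expectation(2)[of p F] by (cases "prime p") auto
  have [measurable]: "?f p \<in> borel_measurable \<mu>" for p
    using int by (rule borel_measurable_integrable)
  have "(\<integral>\<^sup>+\<omega>. (\<Sum>p. ennreal (?f p \<omega>)) \<partial>\<mu>) = (\<Sum>p. \<integral>\<^sup>+\<omega>. ennreal (?f p \<omega>) \<partial>\<mu>)"
    by (rule nn_integral_suminf) measurable
  also have "\<dots> = (\<Sum>p. ennreal (expectation (?f p)))"
    using int nonneg by (intro suminf_cong nn_integral_eq_integral) auto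
  also have "\<dots> \<noteq> top"
  proof (rule ennreal_suminf_neq_top)
    show "summable (\<lambda>p. expectation (?f p))"
    proof (rule summable_comparison_test'[OF summable_mult[OF budget, of K]])
      show "norm (expectation (?f p)) \<le> K * (of_bool (prime p) * prime_budget F p)" for p
        using exp[of p] integral_nonneg_AE[of "?f p" \<mu>] nonneg by auto
    qed
  qed (auto intro: Bochner_Integration.integral_nonneg prime_cost_nonneg)
  finally have "AE \<omega> in \<mu>. (\<Sum>p. ennreal (?f p \<omega>)) \<noteq> \<infinity>"
    by (intro nn_integral_noteq_infinite) auto
  then show ?thesis
    by eventually_elim (rule summable_suminf_not_top, use nonneg in auto)
qed

end

section \<open>Convergence of discrete laws\<close>

text \<open>
  Splitting off one coordinate: \<open>X t = j t\<close> means \<open>X t \<ge> j t\<close> without \<open>X t \<ge> j t + 1\<close>. Because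
  \<open>t \<notin> T\<close>, raising \<open>j\<close> at \<open>t\<close> leaves the equations on \<open>T\<close> intact, so both events on the right
  have the same shape and an induction on \<open>T\<close> is possible.
\<close>

lemma measure_joint_tail_diff:
  fixes X :: "'v \<Rightarrow> 'i \<Rightarrow> nat"
  assumes "prob_space \<mu>" "finite I" "T \<subseteq> I" "t \<in> I" "t \<notin> T"
    and meas: "\<And>t. t \<in> I \<Longrightarrow> (\<lambda>\<omega>. X \<omega> t) \<in> measurable \<mu> (count_space UNIV)"
  shows "measure \<mu> {\<omega> \<in> space \<mu>. (\<forall>s\<in>I. j s \<le> X \<omega> s) \<and> (\<forall>s\<in>insert t T. X \<omega> s = j s)} =
    measure \<mu> {\<omega> \<in> space \<mu>. (\<forall>s\<in>I. j s \<le> X \<omega> s) \<and> (\<forall>s\<in>T. X \<omega> s = j s)} -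
    measure \<mu> {\<omega> \<in> space \<mu>. (\<forall>s\<in>I. (j(t := Suc (j t))) s \<le> X \<omega> s) \<and>
                 (\<forall>s\<in>T. X \<omega> s = (j(t := Suc (j t))) s)}"
    (is "measure \<mu> ?A = measure \<mu> ?B - measure \<mu> ?C")
proof -
  interpret prob_space \<mu> by fact
  have fT: "finite T" using assms finite_subset by blast
  have sets: "?B \<in> sets \<mu>" "?C \<in> sets \<mu>"
  proof -
    have pred: "Measurable.pred \<mu> (\<lambda>\<omega>. P (X \<omega> s))" if "s \<in> I" for P s
      using measurable_compose[OF meas[OF that], of P "count_space UNIV"] by simp
    have "Measurable.pred \<mu> (\<lambda>\<omega>. (\<forall>s\<in>I. k s \<le> X \<omega> s) \<and> (\<forall>s\<in>T. X \<omega> s = k s))" for k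
      using assms(2,3) fT by (intro pred_intros_logic pred_intros_finite) (auto intro: pred)
    then show "?B \<in> sets \<mu>" "?C \<in> sets \<mu>" by (simp_all only: pred_def)
  qed
  have "?C \<subseteq> ?B" using assms(4,5) by (auto split: if_splits)
  moreover have "?A = ?B - ?C"
    using assms(3,4,5) by (auto split: if_splits) 
  ultimately show ?thesis using sets by (simp add: finite_measure_Diff)
qed

text \<open>
  Inequalities are turned into equations one index at a time. The threshold \<open>j\<close> has to vary in the
  induction, as each step uses two different thresholds.
\<close>

lemma point_masses_of_joint_tails:
  fixes X :: "nat \<Rightarrow> 'v \<Rightarrow> 'i \<Rightarrow> nat" and Y :: "'w \<Rightarrow> 'i \<Rightarrow> nat"
  assumes "finite I" "\<And>n. prob_space (P n)" "prob_space M"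
    and X: "\<And>n t. t \<in> I \<Longrightarrow> (\<lambda>\<omega>. X n \<omega> t) \<in> measurable (P n) (count_space UNIV)"
    and Y: "\<And>t. t \<in> I \<Longrightarrow> (\<lambda>\<omega>. Y \<omega> t) \<in> measurable M (count_space UNIV)"
    and tails: "\<And>j. (\<lambda>n. measure (P n) {\<omega> \<in> space (P n). \<forall>t\<in>I. j t \<le> X n \<omega> t})
      \<longlonglongrightarrow> measure M {\<omega> \<in> space M. \<forall>t\<in>I. j t \<le> Y \<omega> t}"
  shows "(\<lambda>n. measure (P n) {\<omega> \<in> space (P n). \<forall>t\<in>I. X n \<omega> t = j t})
      \<longlonglongrightarrow> measure M {\<omega> \<in> space M. \<forall>t\<in>I. Y \<omega> t = j t}"
proof -
  have "(\<lambda>n. measure (P n) {\<omega> \<in> space (P n). (\<forall>t\<in>I. j t \<le> X n \<omega> t) \<and> (\<forall>t\<in>T. X n \<omega> t = j t)})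
      \<longlonglongrightarrow> measure M {\<omega> \<in> space M. (\<forall>t\<in>I. j t \<le> Y \<omega> t) \<and> (\<forall>t\<in>T. Y \<omega> t = j t)}"
    if "T \<subseteq> I" for T
    using finite_subset[OF that \<open>finite I\<close>] that
  proof (induction T arbitrary: j rule: finite_induct)
    case empty
    then show ?case using tails by simp
  next
    case (insert t T)
    have t: "T \<subseteq> I" "t \<in> I" "t \<notin> T" using insert by auto
    note diff_P = measure_joint_tail_diff[OF assms(2,1) t X]
    note diff_M = measure_joint_tail_diff[OF assms(3,1) t Y]
    show ?case
      by (simp only: diff_P diff_M) (intro tendsto_diff insert.IH t)
  qed
  from this[of I] have "(\<lambda>n. measure (P n) {\<omega> \<in> space (P n). (\<forall>t\<in>I. j t \<le> X n \<omega> t) \<and> (\<forall>t\<in>I. X n \<omega> t = j t)})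
      \<longlonglongrightarrow> measure M {\<omega> \<in> space M. (\<forall>t\<in>I. j t \<le> Y \<omega> t) \<and> (\<forall>t\<in>I. Y \<omega> t = j t)}"
    by simp
  moreover have "((\<forall>t\<in>I. j t \<le> f t) \<and> (\<forall>t\<in>I. f t = j t)) = (\<forall>t\<in>I. f t = j t)" for f :: "'i \<Rightarrow> nat"
    by auto
  ultimately show ?thesis by simp
qed

lemma expectation_finite_approx:
  fixes V :: "'v \<Rightarrow> 'c" and h :: "'c \<Rightarrow> real"
  assumes "prob_space \<mu>" and V: "V \<in> measurable \<mu> (count_space UNIV)"
    and h: "\<And>a. \<bar>h a\<bar> \<le> B" and A: "finite A"
  shows "\<bar>(\<integral>\<omega>. h (V \<omega>) \<partial>\<mu>) - (\<Sum>a\<in>A. h a * measure \<mu> {\<omega> \<in> space \<mu>. V \<omega> = a})\<bar>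
    \<le> B * (1 - (\<Sum>a\<in>A. measure \<mu> {\<omega> \<in> space \<mu>. V \<omega> = a}))"
proof -
  interpret prob_space \<mu> by fact
  have [measurable]: "(\<lambda>\<omega>. g (V \<omega>)) \<in> borel_measurable \<mu>" for g :: "'c \<Rightarrow> real"
    using V by (rule measurable_compose) simp
  have B: "0 \<le> B" using h[of undefined] by linarith
  have int: "integrable \<mu> (\<lambda>\<omega>. g (V \<omega>))" if "\<And>a. \<bar>g a\<bar> \<le> C" for g :: "'c \<Rightarrow> real" and C
    using that by (intro integrable_const_bound[of _ C]) auto
  have pt: "(\<integral>\<omega>. (indicator {a} (V \<omega>) :: real) \<partial>\<mu>) = measure \<mu> {\<omega> \<in> space \<mu>. V \<omega> = a}" for a
  proof -
    have "(\<integral>\<omega>. (indicator {a} (V \<omega>) :: real) \<partial>\<mu>) = (\<integral>\<omega>. indicator {\<omega> \<in> space \<mu>. V \<omega> = a} \<omega> \<partial>\<mu>)"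
      by (intro Bochner_Integration.integral_cong) (auto simp: indicator_def)
    then show ?thesis by (simp add: Int_absorb2 Collect_restrict)
  qed
  have sum: "(\<Sum>a\<in>A. g a * measure \<mu> {\<omega> \<in> space \<mu>. V \<omega> = a}) = (\<integral>\<omega>. g (V \<omega>) * indicator A (V \<omega>) \<partial>\<mu>)"
    for g :: "'c \<Rightarrow> real"
  proof -
    have "(\<Sum>a\<in>A. g a * measure \<mu> {\<omega> \<in> space \<mu>. V \<omega> = a}) = (\<Sum>a\<in>A. \<integral>\<omega>. g a * indicator {a} (V \<omega>) \<partial>\<mu>)"
      by (simp add: pt)
    also have "\<dots> = (\<integral>\<omega>. (\<Sum>a\<in>A. g a * indicator {a} (V \<omega>)) \<partial>\<mu>)"
      by (rule Bochner_Integration.integral_sum[symmetric], rule integrable_mult_right, rule int[of _ 1])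
         (auto simp: indicator_def)
    also have "(\<lambda>\<omega>. \<Sum>a\<in>A. g a * indicator {a} (V \<omega>)) = (\<lambda>\<omega>. g (V \<omega>) * indicator A (V \<omega>))"
      using A by (auto simp: indicator_def if_distrib sum.delta cong: if_cong)
    finally show ?thesis .
  qed
  have ih: "integrable \<mu> (\<lambda>\<omega>. h (V \<omega>))" "integrable \<mu> (\<lambda>\<omega>. h (V \<omega>) * indicator A (V \<omega>))"
    "integrable \<mu> (\<lambda>\<omega>. indicator A (V \<omega>) :: real)"
    using int[of h B] int[of "\<lambda>a. h a * indicator A a" B] int[of "indicator A" 1] h B
    by (auto simp: indicator_def)
  have "\<bar>(\<integral>\<omega>. h (V \<omega>) \<partial>\<mu>) - (\<Sum>a\<in>A. h a * measure \<mu> {\<omega> \<in> space \<mu>. V \<omega> = a})\<bar>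
      = \<bar>\<integral>\<omega>. h (V \<omega>) - h (V \<omega>) * indicator A (V \<omega>) \<partial>\<mu>\<bar>"
    unfolding sum using ih by simp
  also have "\<dots> \<le> (\<integral>\<omega>. \<bar>h (V \<omega>) - h (V \<omega>) * indicator A (V \<omega>)\<bar> \<partial>\<mu>)"
    by (rule integral_abs_bound)
  also have "\<dots> \<le> (\<integral>\<omega>. B * (1 - indicator A (V \<omega>)) \<partial>\<mu>)"
    using ih h by (intro integral_mono) (auto simp: indicator_def)
  also have "\<dots> = B * (1 - (\<Sum>a\<in>A. measure \<mu> {\<omega> \<in> space \<mu>. V \<omega> = a}))"
    using sum[of "\<lambda>_. 1"] ih by (simp add: prob_space)
  finally show ?thesis .
qed

lemma exists_finite_carrier:
  fixes V :: "'v \<Rightarrow> 'c::countable"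
  assumes "prob_space \<mu>" and V: "V \<in> measurable \<mu> (count_space UNIV)" and "\<epsilon> > 0"
  shows "\<exists>A. finite A \<and> 1 - (\<Sum>a\<in>A. measure \<mu> {\<omega> \<in> space \<mu>. V \<omega> = a}) < \<epsilon>"
proof -
  interpret prob_space \<mu> by fact
  define E where "E k = {\<omega> \<in> space \<mu>. to_nat (V \<omega>) \<le> k}" for k
  have sets: "{\<omega> \<in> space \<mu>. V \<omega> \<in> S} \<in> sets \<mu>" for S
    using measurable_sets[OF V, of S] by (simp add: vimage_def Int_def conj_commute)
  have "E k \<in> sets \<mu>" for k
    using sets[of "{a. to_nat a \<le> k}"] by (simp add: E_def)
  moreover have "incseq E" by (auto simp: incseq_def E_def)
  moreover have "(\<Union>k. E k) = space \<mu>" by (auto simp: E_def)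
  ultimately have "(\<lambda>k. prob (E k)) \<longlonglongrightarrow> 1"
    using finite_Lim_measure_incseq[of E] by (simp add: prob_space image_subset_iff)
  then have "\<forall>\<^sub>F k in sequentially. prob (E k) > 1 - \<epsilon>"
    using \<open>\<epsilon> > 0\<close> by (intro order_tendstoD) auto
  then obtain k where k: "prob (E k) > 1 - \<epsilon>" by (auto simp: eventually_sequentially)
  define A where "A = {a :: 'c. to_nat a \<le> k}"
  have fin: "finite A"
    unfolding A_def by (rule finite_imageD[of to_nat]) (auto intro: finite_subset[of _ "{..k}"] inj_on_subset[OF inj_to_nat])
  have "E k = (\<Union>a\<in>A. {\<omega> \<in> space \<mu>. V \<omega> = a})" by (auto simp: E_def A_def)
  then have "prob (E k) = (\<Sum>a\<in>A. prob {\<omega> \<in> space \<mu>. V \<omega> = a})"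
    using fin sets[of "{_}"] by (simp, subst finite_measure_finite_Union) (auto simp: disjoint_family_on_def)
  then show ?thesis using k fin by (intro exI[of _ A]) auto
qed

text \<open>
  No mass escapes: a finite set carrying nearly all of the limit law also carries nearly all of the
  approximating laws eventually, since it consists of finitely many points. This applies to arbitrary
  bounded \<open>h\<close>, in particular to indicators.
\<close>

lemma expectation_tendsto_of_point_masses:
  fixes V :: "nat \<Rightarrow> 'v \<Rightarrow> 'c::countable" and U :: "'w \<Rightarrow> 'c" and h :: "'c \<Rightarrow> real"
  assumes P: "\<And>n. prob_space (P n)" and M: "prob_space M"
    and V: "\<And>n. V n \<in> measurable (P n) (count_space UNIV)"
    and U: "U \<in> measurable M (count_space UNIV)"
    and lim: "\<And>a. (\<lambda>n. measure (P n) {\<omega> \<in> space (P n). V n \<omega> = a})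
      \<longlonglongrightarrow> measure M {\<omega> \<in> space M. U \<omega> = a}"
    and h: "\<And>a. \<bar>h a\<bar> \<le> B"
  shows "(\<lambda>n. \<integral>\<omega>. h (V n \<omega>) \<partial>P n) \<longlonglongrightarrow> (\<integral>\<omega>. h (U \<omega>) \<partial>M)"
proof (rule LIMSEQ_I)
  fix r :: real assume "r > 0"
  define p where "p n a = measure (P n) {\<omega> \<in> space (P n). V n \<omega> = a}" for n a
  define q where "q a = measure M {\<omega> \<in> space M. U \<omega> = a}" for a
  have B: "0 \<le> B" using h[of undefined] by linarith
  \<comment> \<open>The error consists of the mass off the finite carrier for both laws and of the difference of the
    finite sums; \<open>B + 1\<close> avoids division by zero.\<close>
  define \<epsilon> where "\<epsilon> = r / (4 * (B + 1))"
  have \<epsilon>: "\<epsilon> > 0" using \<open>r > 0\<close> B by (simp add: \<epsilon>_def)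
  obtain A where A: "finite A" "1 - sum q A < \<epsilon>"
    using exists_finite_carrier[OF M U \<epsilon>] unfolding q_def by blast
  have lim': "(\<lambda>n. p n a) \<longlonglongrightarrow> q a" for a unfolding p_def q_def by (rule lim)
  have "(\<lambda>n. 1 - sum (p n) A) \<longlonglongrightarrow> 1 - sum q A"
    by (intro tendsto_intros lim')
  then have ev1: "\<forall>\<^sub>F n in sequentially. 1 - sum (p n) A < \<epsilon>" using A(2) by (intro order_tendstoD)
  have "(\<lambda>n. \<Sum>a\<in>A. h a * p n a) \<longlonglongrightarrow> (\<Sum>a\<in>A. h a * q a)"
    by (intro tendsto_intros lim')
  then have ev2: "\<forall>\<^sub>F n in sequentially. dist (\<Sum>a\<in>A. h a * p n a) (\<Sum>a\<in>A. h a * q a) < r / 4"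
    using \<open>r > 0\<close> by (intro tendstoD) auto
  have "\<forall>\<^sub>F n in sequentially. norm ((\<integral>\<omega>. h (V n \<omega>) \<partial>P n) - (\<integral>\<omega>. h (U \<omega>) \<partial>M)) < r"
    using ev1 ev2
  proof eventually_elim
    case (elim n)
    have B\<epsilon>: "B * \<epsilon> \<le> r / 4" using \<open>r > 0\<close> B by (simp add: \<epsilon>_def field_simps)
    have "\<bar>(\<integral>\<omega>. h (V n \<omega>) \<partial>P n) - (\<Sum>a\<in>A. h a * p n a)\<bar> \<le> B * (1 - sum (p n) A)"
      unfolding p_def by (rule expectation_finite_approx[OF P V h A(1)])
    also have "\<dots> \<le> B * \<epsilon>" using elim B by (intro mult_left_mono) auto
    finally have 1: "\<bar>(\<integral>\<omega>. h (V n \<omega>) \<partial>P n) - (\<Sum>a\<in>A. h a * p n a)\<bar> \<le> r / 4" using B\<epsilon> by simp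
    have "\<bar>(\<integral>\<omega>. h (U \<omega>) \<partial>M) - (\<Sum>a\<in>A. h a * q a)\<bar> \<le> B * (1 - sum q A)"
      unfolding q_def by (rule expectation_finite_approx[OF M U h A(1)])
    also have "\<dots> \<le> B * \<epsilon>" using A B by (intro mult_left_mono) auto
    finally have 2: "\<bar>(\<integral>\<omega>. h (U \<omega>) \<partial>M) - (\<Sum>a\<in>A. h a * q a)\<bar> \<le> r / 4" using B\<epsilon> by simp
    show ?case using 1 2 elim(2) \<open>r > 0\<close> unfolding dist_real_def real_norm_def by linarith
  qed
  then show "\<exists>no. \<forall>n\<ge>no. norm ((\<integral>\<omega>. h (V n \<omega>) \<partial>P n) - (\<integral>\<omega>. h (U \<omega>) \<partial>M)) < r"
    by (simp add: eventually_sequentially)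
qed

section \<open>Equidistribution in residue classes\<close>

text \<open>
  Translating \<open>A n \<inter> E\<close> by \<open>c\<close> gives the part of the translated set \<open>A n + c\<close> in \<open>E + c\<close>, and
  \<open>A n + c\<close> differs from \<open>A n\<close> by a vanishing proportion on either side.
\<close>

lemma asymptotic_shift_invariance:
  fixes A :: "nat \<Rightarrow> 'g::ab_group_add set"
  assumes fin: "\<And>n. finite (A n)" and ne: "\<And>n. A n \<noteq> {}"
    and inv: "(\<lambda>n. real (card ((\<lambda>x. x + c) ` A n \<inter> A n)) / real (card (A n))) \<longlonglongrightarrow> 1"
  shows "(\<lambda>n. real (card (A n \<inter> (\<lambda>x. x + c) ` E)) / real (card (A n)) -
      real (card (A n \<inter> E)) / real (card (A n))) \<longlonglongrightarrow> 0"
proof (rule Lim_null_comparison)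
  show "\<forall>\<^sub>F n in sequentially. norm (real (card (A n \<inter> (\<lambda>x. x + c) ` E)) / real (card (A n)) -
      real (card (A n \<inter> E)) / real (card (A n)))
      \<le> 1 - real (card ((\<lambda>x. x + c) ` A n \<inter> A n)) / real (card (A n))"
  proof (intro always_eventually allI)
    fix n
    let ?B = "(\<lambda>x. x + c) ` A n" and ?E = "(\<lambda>x. x + c) ` E"
    have inj: "inj_on (\<lambda>x. x + c) S" for S by (auto simp: inj_on_def)
    have cardB: "card ?B = card (A n)" by (rule card_image[OF inj])
    have "?B \<inter> ?E = (\<lambda>x. x + c) ` (A n \<inter> E)" by auto
    then have cardE: "card (?B \<inter> ?E) = card (A n \<inter> E)" by (simp add: card_image[OF inj])
    have split: "card (S \<inter> ?E) \<le> card (T \<inter> ?E) + card (S - T)" if "finite S" "finite T" for S T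
    proof -
      have "card (S \<inter> ?E) \<le> card ((T \<inter> ?E) \<union> (S - T))" using that by (intro card_mono) auto
      also have "\<dots> \<le> card (T \<inter> ?E) + card (S - T)" by (rule card_Un_le)
      finally show ?thesis .
    qed
    have diff: "real (card (S - T)) = real (card S) - real (card (S \<inter> T))" if "finite S" for S T :: "'g set"
      using that by (simp add: card_Diff_subset_Int of_nat_diff card_mono)
    have "\<bar>real (card (A n \<inter> ?E)) - real (card (A n \<inter> E))\<bar> \<le> real (card (A n)) - real (card (?B \<inter> A n))"
      using split[of "A n" ?B] split[of ?B "A n"] diff[of "A n" ?B] diff[of ?B "A n"] fin[of n] cardB cardE
      by (simp add: Int_commute)
    moreover have "card (A n) > 0" using fin ne by (simp add: card_gt_0_iff)
    ultimately show "norm (real (card (A n \<inter> ?E)) / real (card (A n)) -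
      real (card (A n \<inter> E)) / real (card (A n))) \<le> 1 - real (card (?B \<inter> A n)) / real (card (A n))"
      by (simp add: diff_divide_distrib[symmetric] field_simps)
  qed
  show "(\<lambda>n. 1 - real (card ((\<lambda>x. x + c) ` A n \<inter> A n)) / real (card (A n))) \<longlonglongrightarrow> 0"
    using tendsto_diff[OF tendsto_const[of 1] inv] by simp
qed

lemma card_residue_box:
  fixes a :: "'d::finite \<Rightarrow> nat"
  shows "finite {c :: int ^ 'd. \<forall>i. 0 \<le> c $ i \<and> c $ i < int (a i)}"
    and "card {c :: int ^ 'd. \<forall>i. 0 \<le> c $ i \<and> c $ i < int (a i)} = (\<Prod>i\<in>UNIV. a i)"
proof -
  let ?C = "{c :: int ^ 'd. \<forall>i. 0 \<le> c $ i \<and> c $ i < int (a i)}"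
  have bij: "bij_betw vec_lambda (PiE UNIV (\<lambda>i. {0..<int (a i)})) ?C"
    by (rule bij_betw_byWitness[where f' = vec_nth]) (auto simp: PiE_def Pi_def extensional_def)
  have "finite (PiE UNIV (\<lambda>i :: 'd. {0..<int (a i)}))" by (intro finite_PiE) auto
  then show "finite ?C" using bij_betw_finite[OF bij] by simp
  show "card ?C = (\<Prod>i\<in>UNIV. a i)" using bij_betw_same_card[OF bij] by (simp add: card_PiE)
qed

text \<open>
  The residue classes modulo \<open>a\<close> are translates of one another, so they have asymptotically equal
  proportions. As there are \<open>\<Prod>a\<close> of them and the proportions add up to one, each tends to
  \<open>1 / \<Prod>a\<close>. Asymptotic independence of distinct primes is hidden in this product form.
\<close>

lemma divisibility_density:
  fixes A :: "nat \<Rightarrow> (int ^ 'd::finite) set" and a :: "'d \<Rightarrow> nat"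
  assumes fin: "\<And>n. finite (A n)" and ne: "\<And>n. A n \<noteq> {}"
    and inv: "\<And>c. (\<lambda>n. real (card ((\<lambda>x. x + c) ` A n \<inter> A n)) / real (card (A n))) \<longlonglongrightarrow> 1"
    and a: "\<And>i. a i > 0"
  shows "(\<lambda>n. real (card (A n \<inter> {x. \<forall>i. int (a i) dvd x $ i})) / real (card (A n)))
    \<longlonglongrightarrow> 1 / real (\<Prod>i\<in>UNIV. a i)"
proof -
  define C where "C = {c :: int ^ 'd. \<forall>i. 0 \<le> c $ i \<and> c $ i < int (a i)}"
  define E where "E = {x :: int ^ 'd. \<forall>i. int (a i) dvd x $ i}"
  define r where "r n S = real (card (A n \<inter> S)) / real (card (A n))" for n and S :: "(int ^ 'd) set"
  define res where "res x = (\<chi> i. x $ i mod int (a i))" for x :: "int ^ 'd"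
  have C: "finite C" "card C = (\<Prod>i\<in>UNIV. a i)"
    unfolding C_def by (rule card_residue_box)+
  have shift: "(\<lambda>x. x + c) ` E = {x. res x = c}" if "c \<in> C" for c
  proof (intro set_eqI iffI)
    fix x assume "x \<in> {x. res x = c}"
    then have "c $ i = x $ i mod int (a i)" for i by (auto simp: res_def vec_eq_iff)
    then have "x - c \<in> E" by (simp add: E_def minus_mod_eq_mult_div)
    then show "x \<in> (\<lambda>x. x + c) ` E" by (metis image_eqI diff_add_cancel)
  next
    fix x assume "x \<in> (\<lambda>x. x + c) ` E"
    then show "x \<in> {x. res x = c}" using that
      by (auto simp: E_def C_def res_def vec_eq_iff mod_add_eq[symmetric, of "_ $ _"] dvd_eq_mod_eq_0 mod_add_left_eq
          simp flip: mod_add_left_eq)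
  qed
  have total: "(\<Sum>c\<in>C. r n ((\<lambda>x. x + c) ` E)) = 1" for n
  proof -
    have "res ` A n \<subseteq> C" using a by (auto simp: res_def C_def)
    then have "(\<Sum>c\<in>C. card {x \<in> A n. res x = c}) = card (A n)"
      using sum.group[OF fin C(1), of res n "\<lambda>_. 1 :: nat"] by simp
    moreover have "A n \<inter> (\<lambda>x. x + c) ` E = {x \<in> A n. res x = c}" if "c \<in> C" for c
      using shift[OF that] by auto
    ultimately show ?thesis using fin ne
      by (simp add: r_def sum_divide_distrib[symmetric] card_gt_0_iff flip: of_nat_sum)
  qed
  have "(\<lambda>n. \<Sum>c\<in>C. r n ((\<lambda>x. x + c) ` E) - r n E) \<longlonglongrightarrow> (\<Sum>c\<in>C. 0)"
    unfolding r_def by (intro tendsto_sum asymptotic_shift_invariance fin ne inv)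
  then have "(\<lambda>n. 1 - real (card C) * r n E) \<longlonglongrightarrow> 0"
    by (simp add: sum_subtractf total)
  then have "(\<lambda>n. (1 - (1 - real (card C) * r n E)) / real (card C)) \<longlonglongrightarrow> (1 - 0) / real (card C)"
    by (intro tendsto_divide tendsto_diff tendsto_const) (use C a in \<open>auto simp: less_imp_neq\<close>)
  moreover have "real (card C) \<noteq> 0" using C a by (simp add: less_imp_neq[symmetric])
  ultimately have "(\<lambda>n. r n E) \<longlonglongrightarrow> 1 / real (card C)" by simp
  then show ?thesis unfolding C(2) r_def E_def .
qed

lemma int_vec_inj: "inj int_vec"
  by (auto simp: inj_def int_vec_def vec_eq_iff)

lemma prob_multiples_tendsto:
  fixes D :: "nat \<Rightarrow> (nat ^ 'd::finite) set" and a :: "'d \<Rightarrow> nat"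
  assumes fin: "\<And>n. finite (D n)" and ne: "\<And>n. D n \<noteq> {}"
    and inv: "\<And>c. (\<lambda>n. real (card ((\<lambda>x. x + c) ` int_vec ` D n \<inter> int_vec ` D n)) / real (card (D n)))
        \<longlonglongrightarrow> 1"
    and a: "\<And>i. a i > 0"
  shows "(\<lambda>n. measure (pmf_of_set (D n)) {x. \<forall>i. a i dvd x $ i}) \<longlonglongrightarrow> 1 / real (\<Prod>i\<in>UNIV. a i)"
proof -
  have card: "card (int_vec ` S) = card S" for S :: "(nat ^ 'd) set"
    by (rule card_image[OF inj_on_subset[OF int_vec_inj]]) auto
  have "int_vec ` D n \<inter> {x. \<forall>i. int (a i) dvd x $ i} = int_vec ` (D n \<inter> {x. \<forall>i. a i dvd x $ i})" for n
    by (auto simp: int_vec_def)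
  then show ?thesis
    using divisibility_density[of "\<lambda>n. int_vec ` D n" a] assms
    by (simp add: card measure_pmf_of_set)
qed

lemma prod_prime_powers_dvd_iff:
  assumes "finite Q" "\<And>p. p \<in> Q \<Longrightarrow> prime (p::nat)"
  shows "(\<Prod>p\<in>Q. p ^ k p) dvd x \<longleftrightarrow> (\<forall>p\<in>Q. p ^ k p dvd x)"
  using assms
proof (induction Q rule: finite_induct)
  case (insert q Q)
  have "coprime q p" if "p \<in> Q" for p
    using that insert by (metis insertCI primes_coprime)
  then have "coprime (q ^ k q) (\<Prod>p\<in>Q. p ^ k p)" by (auto intro!: prod_coprime_right)
  then have "q ^ k q * (\<Prod>p\<in>Q. p ^ k p) dvd x \<longleftrightarrow> q ^ k q dvd x \<and> (\<Prod>p\<in>Q. p ^ k p) dvd x"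
    by (metis divides_mult dvd_mult_left dvd_mult_right)
  then show ?case using insert by simp
qed simp

section \<open>The two probabilistic models\<close>

lemma geometric_joint_tail:
  fixes G :: "'d::finite \<Rightarrow> nat \<Rightarrow> 'w \<Rightarrow> nat"
  assumes M: "prob_space M"
    and indep: "prob_space.indep_vars M (\<lambda>_. count_space UNIV) (\<lambda>(k, p). G k p) (UNIV \<times> {p. prime p})"
    and tail: "\<And>k p j. prime p \<Longrightarrow> measure M {\<omega> \<in> space M. G k p \<omega> \<ge> j} = 1 / real p ^ j"
    and J: "finite J" "J \<subseteq> UNIV \<times> {p. prime p}"
  shows "measure M {\<omega> \<in> space M. \<forall>t\<in>J. j t \<le> G (fst t) (snd t) \<omega>} = (\<Prod>t\<in>J. 1 / real (snd t) ^ j t)"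
proof -
  interpret prob_space M by fact
  show ?thesis
  proof (cases "J = {}")
    case False
    have "prob (\<Inter>t\<in>J. (\<lambda>(k, p). G k p) t -` {j t..} \<inter> space M) =
        (\<Prod>t\<in>J. prob ((\<lambda>(k, p). G k p) t -` {j t..} \<inter> space M))"
      using False J by (intro indep_varsD[OF indep]) auto
    also have "(\<Inter>t\<in>J. (\<lambda>(k, p). G k p) t -` {j t..} \<inter> space M) =
        {\<omega> \<in> space M. \<forall>t\<in>J. j t \<le> G (fst t) (snd t) \<omega>}"
      using False by (auto simp: split_def)
    also have "(\<Prod>t\<in>J. prob ((\<lambda>(k, p). G k p) t -` {j t..} \<inter> space M)) = (\<Prod>t\<in>J. 1 / real (snd t) ^ j t)"
    proof (rule prod.cong[OF refl])
      fix t assume "t \<in> J"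
      then have "prime (snd t)" using J by auto
      moreover have "(\<lambda>(k, p). G k p) t -` {j t..} \<inter> space M = {\<omega> \<in> space M. j t \<le> G (fst t) (snd t) \<omega>}"
        by (auto simp: split_def)
      ultimately show "prob ((\<lambda>(k, p). G k p) t -` {j t..} \<inter> space M) = 1 / real (snd t) ^ j t"
        using tail by simp
    qed
    finally show ?thesis .
  qed (simp add: prob_space)
qed

lemma indep_geometric_measurable:
  assumes M: "prob_space M"
    and indep: "prob_space.indep_vars M (\<lambda>_. count_space UNIV) (\<lambda>(k, p). G k p) (UNIV \<times> {p. prime p})"
    and p: "prime p"
  shows "G k p \<in> measurable M (count_space UNIV)"
proof -
  interpret prob_space M by fact
  show ?thesis using indep p unfolding indep_vars_def2 by force
qed

text \<open>
  An \<open>N\<close>-smooth vector \<open>a\<close> divides a vector coordinatewise exactly if the exponents dominate those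
  of \<open>a\<close>. Thus \<open>prob_multiples_tendsto\<close> says that the joint tails of the exponents at primes up to
  \<open>N\<close> converge to those of independent geometric variables; from tails one passes to point
  masses, and from these to bounded test functions.
\<close>

lemma smooth_part_expectation_tendsto:
  fixes D :: "nat \<Rightarrow> (nat ^ 'd::finite) set" and G :: "'d \<Rightarrow> nat \<Rightarrow> 'w \<Rightarrow> nat" and h :: "nat ^ 'd \<Rightarrow> real"
  assumes fin: "\<And>n. finite (D n)" and ne: "\<And>n. D n \<noteq> {}" and pos: "\<And>n. D n \<subseteq> pos_vecs"
    and inv: "\<And>c. (\<lambda>n. real (card ((\<lambda>x. x + c) ` int_vec ` D n \<inter> int_vec ` D n)) / real (card (D n)))
        \<longlonglongrightarrow> 1"
    and M: "prob_space M"
    and indep: "prob_space.indep_vars M (\<lambda>_. count_space UNIV) (\<lambda>(k, p). G k p) (UNIV \<times> {p. prime p})"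
    and tail: "\<And>k p j. prime p \<Longrightarrow> measure M {\<omega> \<in> space M. G k p \<omega> \<ge> j} = 1 / real p ^ j"
    and h: "\<And>v. \<bar>h v\<bar> \<le> B"
  shows "(\<lambda>n. \<integral>x. h (smooth_vec (exponents x) N) \<partial>pmf_of_set (D n))
    \<longlonglongrightarrow> (\<integral>\<omega>. h (smooth_vec (\<lambda>i p. G i p \<omega>) N) \<partial>M)"
proof -
  define I where "I = (UNIV :: 'd set) \<times> {p. prime p \<and> p \<le> N}"
  have I: "finite I" "I \<subseteq> UNIV \<times> {p. prime p}" by (auto simp: I_def)
  have G_meas: "G (fst t) (snd t) \<in> measurable M (count_space UNIV)" if "t \<in> I" for t
    using that by (intro indep_geometric_measurable[OF M indep]) (auto simp: I_def)
  have tails: "(\<lambda>n. measure (pmf_of_set (D n))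
        {x \<in> space (measure_pmf (pmf_of_set (D n))). \<forall>t\<in>I. j t \<le> exponents x (fst t) (snd t)})
      \<longlonglongrightarrow> measure M {\<omega> \<in> space M. \<forall>t\<in>I. j t \<le> G (fst t) (snd t) \<omega>}" for j
  proof -
    define a where "a i = (\<Prod>p | prime p \<and> p \<le> N. p ^ j (i, p))" for i
    have a: "a i > 0" for i unfolding a_def by (auto intro!: prod_pos simp: prime_gt_0_nat)
    have "a i dvd m \<longleftrightarrow> (\<forall>p. prime p \<and> p \<le> N \<longrightarrow> p ^ j (i, p) dvd m)" for i m
      unfolding a_def by (subst prod_prime_powers_dvd_iff) auto
    then have "(\<forall>t\<in>I. j t \<le> exponents x (fst t) (snd t)) \<longleftrightarrow> (\<forall>i. a i dvd x $ i)" if "x \<in> pos_vecs" for x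
      using that by (auto simp: I_def le_exponents_iff)
    then have "D n \<inter> {x. \<forall>t\<in>I. j t \<le> exponents x (fst t) (snd t)} = D n \<inter> {x. \<forall>i. a i dvd x $ i}" for n
      using pos[of n] by auto
    then have "measure (pmf_of_set (D n)) {x \<in> space (measure_pmf (pmf_of_set (D n))). \<forall>t\<in>I. j t \<le> exponents x (fst t) (snd t)}
        = measure (pmf_of_set (D n)) {x. \<forall>i. a i dvd x $ i}" for n
      using fin ne by (simp add: measure_pmf_of_set)
    moreover have "measure M {\<omega> \<in> space M. \<forall>t\<in>I. j t \<le> G (fst t) (snd t) \<omega>} = 1 / real (\<Prod>i\<in>UNIV. a i)"
    proof -
      have "measure M {\<omega> \<in> space M. \<forall>t\<in>I. j t \<le> G (fst t) (snd t) \<omega>} = (\<Prod>t\<in>I. 1 / real (snd t) ^ j t)"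
        by (rule geometric_joint_tail[OF M indep tail I])
      also have "\<dots> = (\<Prod>i\<in>UNIV. \<Prod>p | prime p \<and> p \<le> N. 1 / real p ^ j (i, p))"
        unfolding I_def by (simp add: prod.cartesian_product split_def)
      also have "\<dots> = 1 / real (\<Prod>i\<in>UNIV. a i)"
        by (simp add: a_def prod_dividef)
      finally show ?thesis .
    qed
    ultimately show ?thesis
      using prob_multiples_tendsto[OF fin ne inv, of a] a by simp
  qed
  have masses: "(\<lambda>n. measure (pmf_of_set (D n))
        {x \<in> space (measure_pmf (pmf_of_set (D n))). smooth_vec (exponents x) N = v})
      \<longlonglongrightarrow> measure M {\<omega> \<in> space M. smooth_vec (\<lambda>i p. G i p \<omega>) N = v}" for v
  proof (cases "\<exists>e. v = smooth_vec e N")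
    case True
    then obtain e where v: "v = smooth_vec e N" by blast
    have iff: "smooth_vec e' N = v \<longleftrightarrow> (\<forall>t\<in>I. e' (fst t) (snd t) = (\<lambda>(i, p). e i p) t)" for e'
      unfolding v smooth_vec_eq_iff by (auto simp: I_def)
    show ?thesis unfolding iff
      by (rule point_masses_of_joint_tails[OF I(1) prob_space_measure_pmf M _ _ tails]) (auto intro: G_meas)
  next
    case False
    then have "smooth_vec e N \<noteq> v" for e by blast
    then show ?thesis by simp
  qed
  have U: "(\<lambda>\<omega>. smooth_vec (\<lambda>i p. G i p \<omega>) N) \<in> measurable M (count_space UNIV)"
    by (intro smooth_vec_measurable indep_geometric_measurable[OF M indep])
  show ?thesis
    by (rule expectation_tendsto_of_point_masses[OF prob_space_measure_pmf M _ U masses h]) simp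
qed

lemma divisibility_bounds_geometric:
  fixes G :: "'d::finite \<Rightarrow> nat \<Rightarrow> 'w \<Rightarrow> nat"
  assumes "2 \<le> CARD('d)" and M: "prob_space M"
    and indep: "prob_space.indep_vars M (\<lambda>_. count_space UNIV) (\<lambda>(k, p). G k p) (UNIV \<times> {p. prime p})"
    and tail: "\<And>k p j. prime p \<Longrightarrow> measure M {\<omega> \<in> space M. G k p \<omega> \<ge> j} = 1 / real p ^ j"
  shows "divisibility_bounds M (\<lambda>\<omega> i p. G i p \<omega>) 1"
proof -
  interpret prob_space M by fact
  show ?thesis
  proof
    fix p :: nat and i j :: 'd and a b :: nat assume p: "prime p" and ij: "i \<noteq> j"
    have "prob {\<omega> \<in> space M. \<forall>t\<in>{(i, p), (j, p)}. (if t = (i, p) then a else b) \<le> G (fst t) (snd t) \<omega>}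
        = (\<Prod>t\<in>{(i, p), (j, p)}. 1 / real (snd t) ^ (if t = (i, p) then a else b))"
      using p by (intro geometric_joint_tail[OF M indep tail]) auto
    also have "{\<omega> \<in> space M. \<forall>t\<in>{(i, p), (j, p)}. (if t = (i, p) then a else b) \<le> G (fst t) (snd t) \<omega>}
        = {\<omega> \<in> space M. a \<le> G i p \<omega> \<and> b \<le> G j p \<omega>}"
      using ij by auto
    finally show "prob {\<omega> \<in> space M. a \<le> G i p \<omega> \<and> b \<le> G j p \<omega>} \<le> 1 / (real (p ^ a) * real (p ^ b))"
      using ij by simp
  qed (use assms in \<open>auto intro: indep_geometric_measurable[OF M indep]\<close>)
qed

lemma divisibility_bounds_uniform:
  fixes D :: "(nat ^ 'd::finite) set"
  assumes "2 \<le> CARD('d)" "0 < K" and D: "finite D" "D \<noteq> {}" "D \<subseteq> pos_vecs"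
    and bound: "\<And>i j a b. \<lbrakk>i \<noteq> j; a \<ge> 1; b \<ge> 1\<rbrakk> \<Longrightarrow>
      real (card (int_vec ` D \<inter> coord_multiples i a \<inter> coord_multiples j b)) / real (card D)
        \<le> K / (real a * real b)"
  shows "divisibility_bounds (measure_pmf (pmf_of_set D)) exponents K"
proof
  fix p :: nat and i j :: 'd and a b :: nat assume p: "prime p" and ij: "i \<noteq> j"
  have "int_vec ` D \<inter> coord_multiples i (p ^ a) \<inter> coord_multiples j (p ^ b)
      = int_vec ` (D \<inter> {x. a \<le> exponents x i p \<and> b \<le> exponents x j p})"
    using D(3) by (auto simp: coord_multiples_def int_vec_def le_exponents_iff[OF _ p] subset_iff
        simp flip: of_nat_power)
  moreover have "card (int_vec ` S) = card S" for S :: "(nat ^ 'd) set"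
    by (rule card_image[OF inj_on_subset[OF int_vec_inj]]) auto
  moreover have "p ^ a \<ge> 1" "p ^ b \<ge> 1" using p by (auto simp: Suc_le_eq prime_gt_0_nat)
  ultimately show "measure_pmf.prob (pmf_of_set D)
      {x \<in> space (measure_pmf (pmf_of_set D)). a \<le> exponents x i p \<and> b \<le> exponents x j p}
      \<le> K / (real (p ^ a) * real (p ^ b))"
    using bound[OF ij, of "p ^ a" "p ^ b"] D by (simp add: measure_pmf_of_set)
qed (use assms in auto)

section \<open>Convergence of Euler products\<close>

text \<open>
  Once the tail of the costs is small, later partial products arise from earlier ones by a factor
  \<open>exp s\<close> with \<open>s\<close> small, and they stay bounded; so they form a Cauchy sequence. A factor \<open>0\<close> at some
  early prime causes no trouble.
\<close>

lemma euler_part_convergent: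
  assumes F: "multiplicative_vec F"
    and cost: "summable (\<lambda>p. of_bool (prime p) * prime_cost F e p)"
  shows "convergent (\<lambda>N. euler_part F e N)"
proof -
  have tail: "\<exists>N. \<forall>m\<ge>N. \<forall>n\<ge>m. \<exists>s. euler_part F e n = euler_part F e m * exp s \<and> norm s \<le> \<delta>"
    if \<delta>: "0 < \<delta>" "\<delta> < 1" for \<delta>
  proof -
    obtain N where N: "\<And>m n. m \<ge> N \<Longrightarrow> norm (\<Sum>p\<in>{m..<n}. of_bool (prime p) * prime_cost F e p) < \<delta>"
      using cost \<delta>(1) unfolding summable_Cauchy by blast
    have "\<exists>s. euler_part F e n = euler_part F e m * exp s \<and> norm s \<le> \<delta>" if "m \<ge> N" "n \<ge> m" for m n
    proof (rule euler_part_tail_eq_exp[OF F \<open>n \<ge> m\<close> _ \<delta>(2)])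
      have "(\<Sum>p | prime p \<and> m < p \<and> p \<le> n. prime_cost F e p)
          = (\<Sum>p\<in>{Suc m..<Suc n}. of_bool (prime p) * prime_cost F e p)"
        by (rule sum.mono_neutral_cong_left) auto
      also have "\<dots> \<le> \<delta>" using N[of "Suc m" "Suc n"] \<open>m \<ge> N\<close> by (simp add: abs_less_iff)
      finally show "(\<Sum>p | prime p \<and> m < p \<and> p \<le> n. prime_cost F e p) \<le> \<delta>" .
    qed
    then show ?thesis by blast
  qed
  obtain N0 where N0: "\<And>n. n \<ge> N0 \<Longrightarrow> \<exists>s. euler_part F e n = euler_part F e N0 * exp s \<and> norm s \<le> 1/2"
    using tail[of "1/2"] by auto
  define R where "R = norm (euler_part F e N0) * exp (1/2)"
  have R: "norm (euler_part F e n) \<le> R" if n: "n \<ge> N0" for n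
  proof -
    obtain s where s: "euler_part F e n = euler_part F e N0 * exp s" "norm s \<le> 1/2"
      using N0[OF n] by blast
    have "norm (exp s) \<le> exp (1/2)" using norm_exp[of s] s(2) by (meson exp_le_cancel_iff order_trans)
    then show ?thesis unfolding R_def s(1) norm_mult by (intro mult_left_mono) auto
  qed
  have "R \<ge> 0" by (simp add: R_def)
  have "Cauchy (\<lambda>N. euler_part F e N)"
  proof (rule CauchyI')
    fix \<epsilon> :: real assume "\<epsilon> > 0"
    have "isCont (exp :: complex \<Rightarrow> complex) 0" by simp
    then obtain d where d: "d > 0" "\<And>s :: complex. norm s < d \<Longrightarrow> norm (exp s - 1) < \<epsilon> / (R + 1)"
      using \<open>\<epsilon> > 0\<close> \<open>R \<ge> 0\<close> unfolding continuous_at_eps_delta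
      by (auto simp: dist_norm dest!: spec[of _ "\<epsilon> / (R + 1)"])
    define \<delta> where "\<delta> = min (d / 2) (1 / 2)"
    have \<delta>: "0 < \<delta>" "\<delta> < 1" "\<delta> < d" using d(1) by (auto simp: \<delta>_def)
    obtain N where N: "\<And>m n. m \<ge> N \<Longrightarrow> n \<ge> m \<Longrightarrow>
        \<exists>s. euler_part F e n = euler_part F e m * exp s \<and> norm s \<le> \<delta>"
      using tail[OF \<delta>(1,2)] by blast
    have "dist (euler_part F e m) (euler_part F e n) < \<epsilon>" if m: "m \<ge> max N N0" and "n > m" for m n
    proof -
      have "m \<ge> N" "n \<ge> m" using that by auto
      then obtain s where s: "euler_part F e n = euler_part F e m * exp s" "norm s \<le> \<delta>"
        using N by blast
      have "dist (euler_part F e m) (euler_part F e n) = norm (euler_part F e m) * norm (exp s - 1)"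
        unfolding s(1) dist_norm by (simp flip: norm_mult add: algebra_simps norm_minus_commute)
      also have "\<dots> \<le> R * (\<epsilon> / (R + 1))"
        using R[of m] m d(2)[of s] s(2) \<delta>(3) \<open>R \<ge> 0\<close> by (intro mult_mono) auto
      also have "\<dots> < \<epsilon>" using \<open>R \<ge> 0\<close> \<open>\<epsilon> > 0\<close> by (simp add: field_simps)
      finally show ?thesis .
    qed
    then show "\<exists>M. \<forall>m\<ge>M. \<forall>n>m. dist (euler_part F e m) (euler_part F e n) < \<epsilon>" by blast
  qed
  then show ?thesis by (rule Cauchy_convergent)
qed

text \<open>
  Uniform continuity of \<open>(z, s) \<mapsto> f (z * exp s)\<close> on a compact set; the bound on \<open>z\<close> cannot be
  dropped because \<open>f\<close> is merely continuous.
\<close>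

lemma continuous_exp_perturbation:
  fixes f :: "complex \<Rightarrow> real"
  assumes f: "continuous_on UNIV f" and "\<epsilon> > 0"
  shows "\<exists>\<delta>. 0 < \<delta> \<and> \<delta> < 1 \<and> (\<forall>z s. norm z \<le> R \<longrightarrow> norm s \<le> \<delta> \<longrightarrow> \<bar>f (z * exp s) - f z\<bar> \<le> \<epsilon>)"
proof -
  let ?g = "\<lambda>(z, s). f (z * exp s)" and ?S = "cball 0 R \<times> cball 0 1 :: (complex \<times> complex) set"
  have "continuous_on ?S ?g"
    unfolding split_def by (intro continuous_on_compose2[OF f] continuous_intros) auto
  moreover have "compact ?S" by (intro compact_Times compact_cball)
  ultimately have "uniformly_continuous_on ?S ?g" by (rule compact_uniformly_continuous)
  then obtain d where d: "d > 0" "\<And>x y. x \<in> ?S \<Longrightarrow> y \<in> ?S \<Longrightarrow> dist y x < d \<Longrightarrow> dist (?g y) (?g x) < \<epsilon>"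
    unfolding uniformly_continuous_on_def using \<open>\<epsilon> > 0\<close> by metis
  show ?thesis
  proof (intro exI conjI allI impI)
    show "0 < min (d / 2) (1 / 2)" "min (d / 2) (1 / 2) < 1" using d(1) by auto
    fix z s :: complex assume "norm z \<le> R" and s: "norm s \<le> min (d / 2) (1 / 2)"
    then have "dist (?g (z, s)) (?g (z, 0)) < \<epsilon>"
      using d(1) by (intro d(2)) (auto simp: dist_Pair_Pair)
    then show "\<bar>f (z * exp s) - f z\<bar> \<le> \<epsilon>" by (simp add: dist_real_def)
  qed
qed

text \<open>
  A convergent sequence is bounded, so the events that some \<open>Z N\<close> exceeds \<open>k\<close> decrease to a null
  set as \<open>k\<close> grows; one of them with small probability controls all \<open>N\<close> at once.
\<close>

lemma AE_convergent_imp_uniformly_tight: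
  fixes Z :: "nat \<Rightarrow> 'w \<Rightarrow> complex"
  assumes "prob_space M" and [measurable]: "\<And>N. Z N \<in> borel_measurable M"
    and conv: "AE \<omega> in M. convergent (\<lambda>N. Z N \<omega>)" and "\<eta> > 0"
  shows "\<exists>R. \<forall>N. measure M {\<omega> \<in> space M. R < norm (Z N \<omega>)} < \<eta>"
proof -
  interpret prob_space M by fact
  define E where "E k = {\<omega> \<in> space M. \<exists>N. real k < norm (Z N \<omega>)}" for k :: nat
  have [measurable]: "E k \<in> events" for k unfolding E_def by measurable
  have "decseq E" by (auto simp: decseq_def E_def) (meson of_nat_mono order_le_less_trans)
  then have lim: "(\<lambda>k. prob (E k)) \<longlonglongrightarrow> prob (\<Inter>k. E k)"
    by (intro finite_Lim_measure_decseq) auto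
  have "AE \<omega> in M. \<omega> \<notin> (\<Inter>k. E k)"
    using conv
  proof eventually_elim
    case (elim \<omega>)
    then obtain C where C: "\<And>N. norm (Z N \<omega>) \<le> C"
      using convergent_imp_Bseq[of "\<lambda>N. Z N \<omega>"] by (auto simp: Bseq_def)
    obtain k :: nat where "C \<le> real k" using real_arch_simple by blast
    then have "\<omega> \<notin> E k" using C by (auto simp: E_def not_less intro: order_trans)
    then show ?case by blast
  qed
  then have "prob (\<Inter>k. E k) = 0"
    by (subst prob_eq_0) auto
  then have "\<forall>\<^sub>F k in sequentially. prob (E k) < \<eta>"
    using lim \<open>\<eta> > 0\<close> by (intro order_tendstoD) auto
  then obtain k where k: "prob (E k) < \<eta>" by (auto simp: eventually_sequentially)
  have "prob {\<omega> \<in> space M. real k < norm (Z N \<omega>)} \<le> prob (E k)" for N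
    by (intro finite_measure_mono) (auto simp: E_def)
  then show ?thesis using k by (intro exI[of _ "real k"]) (auto intro: order_le_less_trans)
qed

lemma expectation_close_off_bad_event:
  fixes g h :: "'c \<Rightarrow> real" and p :: "'c pmf"
  assumes fin: "finite (set_pmf p)" and B: "\<And>x. \<bar>g x\<bar> \<le> B" "\<And>x. \<bar>h x\<bar> \<le> B"
    and close: "\<And>x. \<lbrakk>x \<in> set_pmf p; x \<notin> S; x \<notin> T\<rbrakk> \<Longrightarrow> \<bar>g x - h x\<bar> \<le> \<epsilon>" and "0 \<le> \<epsilon>"
  shows "\<bar>(\<integral>x. g x \<partial>p) - (\<integral>x. h x \<partial>p)\<bar> \<le> \<epsilon> + 2 * B * (measure p S + measure p T)"
proof -
  have int: "integrable p u" for u :: "'c \<Rightarrow> real" by (rule integrable_measure_pmf_finite[OF fin])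
  have B0: "0 \<le> B" using B(1)[of undefined] by linarith
  have "\<bar>(\<integral>x. g x \<partial>p) - (\<integral>x. h x \<partial>p)\<bar> = \<bar>\<integral>x. g x - h x \<partial>p\<bar>"
    using int by simp
  also have "\<dots> \<le> (\<integral>x. \<bar>g x - h x\<bar> \<partial>p)" by (rule integral_abs_bound)
  also have "\<dots> \<le> (\<integral>x. \<epsilon> + 2 * B * (indicator S x + indicator T x) \<partial>p)"
  proof (rule integral_mono_AE[OF int int], rule AE_pmfI)
    fix x assume x: "x \<in> set_pmf p"
    have "\<bar>g x - h x\<bar> \<le> 2 * B" using B(1)[of x] B(2)[of x] by linarith
    then show "\<bar>g x - h x\<bar> \<le> \<epsilon> + 2 * B * (indicator S x + indicator T x)"
      using close[OF x] \<open>0 \<le> \<epsilon>\<close> B0 by (auto simp: indicator_def)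
  qed
  also have "\<dots> = \<epsilon> + 2 * B * (measure p S + measure p T)"
    using int by simp
  finally show ?thesis .
qed

text \<open>
  The order of the choices matters. First \<open>R\<close> is chosen from the limiting model alone, uniformly in the
  truncation \<open>N\<close>; then \<open>\<delta>\<close> from \<open>R\<close> and the test function; then \<open>N\<close>, uniformly in \<open>n\<close>, so
  that the cost beyond \<open>N\<close> exceeds \<open>\<delta>\<close> only rarely; and \<open>n\<close> last, so that for this fixed \<open>N\<close> the
  truncated expectations and the probability of \<open>norm (F (smooth_vec (exponents x) N)) > R\<close> are close
  to their limits.
\<close>

lemma expectation_tendsto_euler_product:
  fixes D :: "nat \<Rightarrow> (nat ^ 'd::finite) set" and F :: "nat ^ 'd \<Rightarrow> complex" and f :: "complex \<Rightarrow> real"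
    and e :: "'w \<Rightarrow> 'd \<Rightarrow> nat \<Rightarrow> nat"
  assumes F: "multiplicative_vec F"
    and budget: "summable (\<lambda>p. of_bool (prime p) * prime_budget F p)"
    and M: "divisibility_bounds M e K'"
    and D: "\<And>n. finite (D n)" "\<And>n. D n \<noteq> {}" "\<And>n. D n \<subseteq> pos_vecs"
    and \<mu>: "\<And>n. divisibility_bounds (measure_pmf (pmf_of_set (D n))) exponents K"
    and trunc: "\<And>N (h :: nat ^ 'd \<Rightarrow> real) B. (\<And>v. \<bar>h v\<bar> \<le> B) \<Longrightarrow>
      (\<lambda>n. \<integral>x. h (smooth_vec (exponents x) N) \<partial>pmf_of_set (D n)) \<longlonglongrightarrow> (\<integral>\<omega>. h (smooth_vec (e \<omega>) N) \<partial>M)"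
    and f: "continuous_on UNIV f" "\<And>z. \<bar>f z\<bar> \<le> B"
  shows "(\<lambda>n. \<integral>x. f (F x) \<partial>pmf_of_set (D n)) \<longlonglongrightarrow> (\<integral>\<omega>. f (lim (\<lambda>N. euler_part F (e \<omega>) N)) \<partial>M)"
proof (rule LIMSEQ_I)
  fix r :: real assume r: "r > 0"
  interpret M: divisibility_bounds M e K' by fact
  let ?\<mu> = "\<lambda>n. pmf_of_set (D n)"
  define Z where "Z N \<omega> = F (smooth_vec (e \<omega>) N)" for N \<omega>
  have Z: "Z N \<omega> = euler_part F (e \<omega>) N" for N \<omega> unfolding Z_def by (rule F_smooth_vec[OF F])
  have Z_meas: "Z N \<in> borel_measurable M" for N
    unfolding Z_def by (rule measurable_compose[OF smooth_vec_measurable]) (auto intro: M.measurable_exponent)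
  have f_meas: "f \<in> borel_measurable borel" using f(1) by (rule borel_measurable_continuous_onI)
  have conv: "AE \<omega> in M. convergent (\<lambda>N. Z N \<omega>)"
    using M.AE_summable_prime_cost[OF budget] unfolding Z
    by eventually_elim (rule euler_part_convergent[OF F])
  have Z_lim: "(\<lambda>N. \<integral>\<omega>. f (Z N \<omega>) \<partial>M) \<longlonglongrightarrow> (\<integral>\<omega>. f (lim (\<lambda>N. Z N \<omega>)) \<partial>M)"
  proof (rule integral_dominated_convergence[where w = "\<lambda>_. B"])
    show "AE \<omega> in M. (\<lambda>N. f (Z N \<omega>)) \<longlonglongrightarrow> f (lim (\<lambda>N. Z N \<omega>))"
      using conv
      by eventually_elim (rule continuous_on_tendsto_compose[OF f(1)], auto simp: convergent_LIMSEQ_iff)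
    show "(\<lambda>\<omega>. f (lim (\<lambda>N. Z N \<omega>))) \<in> borel_measurable M"
      by (rule measurable_compose[OF borel_measurable_lim_metric[OF Z_meas] f_meas])
    show "(\<lambda>\<omega>. f (Z N \<omega>)) \<in> borel_measurable M" for N
      by (rule measurable_compose[OF Z_meas f_meas])
  qed (use f(2) in auto)

  have B: "0 \<le> B" using f(2)[of undefined] by linarith
  have K: "0 < K" using \<mu>[of 0] by (rule divisibility_bounds.K_pos)
  \<comment> \<open>Error budget: \<open>r / 8\<close> each for the perturbation on the good event, for the truncated limit at \<open>N\<close>
    and for the convergence in \<open>n\<close>, and \<open>4 * B * \<eta> \<le> r / 4\<close> for the two bad events.\<close>
  define \<eta> where "\<eta> = r / (16 * (B + 1))"
  have \<eta>: "\<eta> > 0" "B * \<eta> \<le> r / 16" using r B by (auto simp: \<eta>_def field_simps)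
  obtain R where R: "\<And>N. measure M {\<omega> \<in> space M. R < norm (Z N \<omega>)} < \<eta>"
    using AE_convergent_imp_uniformly_tight[OF M.prob_space_axioms Z_meas conv \<eta>(1)] by blast
  obtain \<delta> where \<delta>: "0 < \<delta>" "\<delta> < 1"
    "\<And>z s. norm z \<le> R \<Longrightarrow> norm s \<le> \<delta> \<Longrightarrow> \<bar>f (z * exp s) - f z\<bar> \<le> r / 8"
    using continuous_exp_perturbation[OF f(1), of "r / 8" R] r by auto

  have "\<forall>\<^sub>F N in sequentially. dist (\<integral>\<omega>. f (Z N \<omega>) \<partial>M) (\<integral>\<omega>. f (lim (\<lambda>N. Z N \<omega>)) \<partial>M) < r / 8"
    using r by (intro tendstoD[OF Z_lim]) auto
  then obtain N1 where N1: "\<And>N. N \<ge> N1 \<Longrightarrow>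
      \<bar>(\<integral>\<omega>. f (Z N \<omega>) \<partial>M) - (\<integral>\<omega>. f (lim (\<lambda>N. Z N \<omega>)) \<partial>M)\<bar> < r / 8"
    by (auto simp: eventually_sequentially dist_real_def)
  obtain N2 where N2: "\<And>m n. m \<ge> N2 \<Longrightarrow>
      norm (\<Sum>p\<in>{m..<n}. of_bool (prime p) * prime_budget F p) < \<eta> * \<delta> / K"
    using budget \<eta>(1) \<delta>(1) K unfolding summable_Cauchy by (metis divide_pos_pos mult_pos_pos)
  define N where "N = max N1 N2"

  have rough: "\<bar>(\<integral>x. f (F x) \<partial>?\<mu> n) - (\<integral>x. f (F (smooth_vec (exponents x) N)) \<partial>?\<mu> n)\<bar>
      \<le> r / 8 + 2 * B * (\<eta> + measure (?\<mu> n) {x. R < norm (F (smooth_vec (exponents x) N))})" for n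
  proof -
    interpret \<mu>: divisibility_bounds "measure_pmf (?\<mu> n)" exponents K by (rule \<mu>)
    \<comment> \<open>All prime factors of coordinates of points of \<open>D n\<close> are at most \<open>L\<close>, so \<open>F x\<close> is its own
      Euler product up to \<open>L\<close> and only finitely many primes beyond \<open>N\<close> matter.\<close>
    define L where "L = max N (Max ((\<lambda>(x, i). x $ i) ` (D n \<times> UNIV)))"
    have L: "x $ i \<le> L" if "x \<in> D n" for x i
    proof -
      have "x $ i \<le> Max ((\<lambda>(x, i). x $ i) ` (D n \<times> UNIV))"
        using that D(1) by (intro Max_ge) (auto intro!: image_eqI[of _ _ "(x, i)"])
      then show ?thesis by (simp add: L_def)
    qed
    define Q where "Q = {p. prime p \<and> N < p \<and> p \<le> L}"
    have Q: "finite Q" "\<And>p. p \<in> Q \<Longrightarrow> prime p" by (auto simp: Q_def intro: finite_subset[of _ "{..L}"])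
    define S where "S = {x. \<delta> \<le> (\<Sum>p\<in>Q. prime_cost F (exponents x) p)}"
    have "measure (?\<mu> n) S \<le> K * (\<Sum>p\<in>Q. prime_budget F p) / \<delta>"
      using \<mu>.prime_cost_Markov[OF Q \<delta>(1)] by (simp add: S_def)
    also have "(\<Sum>p\<in>Q. prime_budget F p) = (\<Sum>p\<in>{Suc N..<Suc L}. of_bool (prime p) * prime_budget F p)"
      by (rule sum.mono_neutral_cong_left) (auto simp: Q_def)
    also have "K * \<dots> / \<delta> \<le> K * (\<eta> * \<delta> / K) / \<delta>"
    proof (intro divide_right_mono mult_left_mono)
      have "N2 \<le> Suc N" by (simp add: N_def)
      from N2[OF this, of "Suc L"]
      show "(\<Sum>p\<in>{Suc N..<Suc L}. of_bool (prime p) * prime_budget F p) \<le> \<eta> * \<delta> / K"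
        unfolding real_norm_def by linarith
    qed (use K \<delta>(1) in auto)
    also have "\<dots> = \<eta>" using K \<delta>(1) by simp
    finally have S: "measure (?\<mu> n) S \<le> \<eta>" .
    have "\<bar>f (F x) - f (F (smooth_vec (exponents x) N))\<bar> \<le> r / 8"
      if x_good: "x \<in> set_pmf (?\<mu> n)" "x \<notin> S" "x \<notin> {x. R < norm (F (smooth_vec (exponents x) N))}" for x
    proof -
      have x: "x \<in> D n" using x_good(1) D by simp
      have "F x = F (smooth_vec (exponents x) L)"
        using smooth_vec_exponents[of x L] L[OF x] x D(3)[of n] by (simp add: subset_iff)
      moreover obtain s where "euler_part F (exponents x) L = euler_part F (exponents x) N * exp s" "norm s \<le> \<delta>"
        using euler_part_tail_eq_exp[OF F, of N L "exponents x" \<delta>] x_good(2) \<delta>(2)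
        by (auto simp: S_def Q_def L_def)
      ultimately show ?thesis
        using \<delta>(3) x_good(3) by (simp add: F_smooth_vec[OF F])
    qed
    then have "\<bar>(\<integral>x. f (F x) \<partial>?\<mu> n) - (\<integral>x. f (F (smooth_vec (exponents x) N)) \<partial>?\<mu> n)\<bar>
      \<le> r / 8 + 2 * B * (measure (?\<mu> n) S + measure (?\<mu> n) {x. R < norm (F (smooth_vec (exponents x) N))})"
      using r D f(2) by (intro expectation_close_off_bad_event) auto
    also have "\<dots> \<le> r / 8 + 2 * B * (\<eta> + measure (?\<mu> n) {x. R < norm (F (smooth_vec (exponents x) N))})"
      using S B by (intro add_left_mono mult_left_mono) auto
    finally show ?thesis .
  qed

  \<comment> \<open>Tightness of the truncated products under the uniform laws is inherited from the limit, by testing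
    with the indicator of large values, which is legitimate for discrete laws.\<close>
  have "(\<lambda>n. \<integral>x. (of_bool (R < norm (F (smooth_vec (exponents x) N))) :: real) \<partial>?\<mu> n)
      \<longlonglongrightarrow> (\<integral>\<omega>. (of_bool (R < norm (F (smooth_vec (e \<omega>) N))) :: real) \<partial>M)"
    by (rule trunc[where B = 1 and h = "\<lambda>v. of_bool (R < norm (F v))"]) auto
  also have "(\<lambda>n. \<integral>x. (of_bool (R < norm (F (smooth_vec (exponents x) N))) :: real) \<partial>?\<mu> n)
      = (\<lambda>n. measure (?\<mu> n) {x. R < norm (F (smooth_vec (exponents x) N))})"
  proof
    fix n
    have "(\<lambda>x. of_bool (R < norm (F (smooth_vec (exponents x) N))) :: real)
        = indicator {x. R < norm (F (smooth_vec (exponents x) N))}" by (auto simp: indicator_def)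
    then show "(\<integral>x. (of_bool (R < norm (F (smooth_vec (exponents x) N))) :: real) \<partial>?\<mu> n)
      = measure (?\<mu> n) {x. R < norm (F (smooth_vec (exponents x) N))}" by simp
  qed
  also have "(\<integral>\<omega>. (of_bool (R < norm (F (smooth_vec (e \<omega>) N))) :: real) \<partial>M)
      = measure M {\<omega> \<in> space M. R < norm (Z N \<omega>)}"
  proof -
    have "(\<integral>\<omega>. (of_bool (R < norm (F (smooth_vec (e \<omega>) N))) :: real) \<partial>M)
        = (\<integral>\<omega>. indicator {\<omega> \<in> space M. R < norm (Z N \<omega>)} \<omega> \<partial>M)"
      by (intro Bochner_Integration.integral_cong) (auto simp: Z_def indicator_def)
    then show ?thesis by (simp add: Int_absorb2 Collect_restrict)
  qed
  finally have "\<forall>\<^sub>F n in sequentially. measure (?\<mu> n) {x. R < norm (F (smooth_vec (exponents x) N))} < \<eta>"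
    using R[of N] by (rule order_tendstoD)
  moreover have "\<forall>\<^sub>F n in sequentially.
      dist (\<integral>x. f (F (smooth_vec (exponents x) N)) \<partial>?\<mu> n) (\<integral>\<omega>. f (F (smooth_vec (e \<omega>) N)) \<partial>M) < r / 8"
    using r f(2) by (intro tendstoD[OF trunc[where h = "\<lambda>v. f (F v)"]]) auto
  ultimately have "\<forall>\<^sub>F n in sequentially. norm ((\<integral>x. f (F x) \<partial>?\<mu> n) - (\<integral>\<omega>. f (lim (\<lambda>N. Z N \<omega>)) \<partial>M)) < r"
  proof eventually_elim
    case (elim n)
    have "2 * B * (\<eta> + measure (?\<mu> n) {x. R < norm (F (smooth_vec (exponents x) N))}) \<le> 2 * B * (\<eta> + \<eta>)"
      using elim(1) B by (intro mult_left_mono) auto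
    also have "\<dots> \<le> r / 4" using \<eta>(2) by (simp add: algebra_simps)
    finally have 1: "\<bar>(\<integral>x. f (F x) \<partial>?\<mu> n) - (\<integral>x. f (F (smooth_vec (exponents x) N)) \<partial>?\<mu> n)\<bar> \<le> r / 8 + r / 4"
      using rough[of n] by linarith
    have 2: "\<bar>(\<integral>x. f (F (smooth_vec (exponents x) N)) \<partial>?\<mu> n) - (\<integral>\<omega>. f (Z N \<omega>) \<partial>M)\<bar> < r / 8"
      using elim(2) by (simp add: dist_real_def Z_def)
    show ?case using 1 2 N1[of N] r unfolding N_def real_norm_def by linarith
  qed
  then show "\<exists>no. \<forall>n\<ge>no. norm ((\<integral>x. f (F x) \<partial>?\<mu> n) - (\<integral>\<omega>. f (lim (\<lambda>N. euler_part F (e \<omega>) N)) \<partial>M)) < r"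
    by (simp add: eventually_sequentially Z)
qed

theorem theorem2p4:
  fixes F :: "nat ^ 'd::finite \<Rightarrow> complex"
    and D :: "nat \<Rightarrow> (nat ^ 'd) set"
    and P :: "nat \<Rightarrow> 'v measure" and X :: "nat \<Rightarrow> 'v \<Rightarrow> nat ^ 'd"
    and M :: "'w measure" and G :: "'d \<Rightarrow> nat \<Rightarrow> 'w \<Rightarrow> nat"
  assumes "CARD('d) \<ge> 2"
    and "multiplicative_vec F"
    and "\<And>i. finite {p. prime p \<and> F (single_coord i p) \<in> \<real>\<^sub>\<le>\<^sub>0}"
    and "\<And>i A. A > 0 \<Longrightarrow>
      (\<lambda>p. 1 / real p * of_bool (norm (log_coord F i p) > A)) summable_on log_primes F i"
    and "\<And>i A. A > 0 \<Longrightarrow>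
      (\<lambda>p. 1 / real p * norm (log_coord F i p) * of_bool (norm (log_coord F i p) \<le> A))
        summable_on log_primes F i"
    and "\<And>n. finite (D n)" and "\<And>n. D n \<noteq> {}" and "\<And>n. D n \<subseteq> pos_vecs"
    and "\<And>c :: int ^ 'd.
      (\<lambda>n. real (card ((\<lambda>x. x + c) ` int_vec ` D n \<inter> int_vec ` D n)) / real (card (D n)))
        \<longlonglongrightarrow> 1"
    and "\<exists>K>0. \<forall>i j a b n. i \<noteq> j \<longrightarrow> a \<ge> 1 \<longrightarrow> b \<ge> 1 \<longrightarrow>
      real (card (int_vec ` D n \<inter> coord_multiples i a \<inter> coord_multiples j b)) / real (card (D n))
        \<le> K / (real a * real b)"
    and "\<And>n. prob_space (P n)"
    and "\<And>n. X n \<in> measurable (P n) (count_space UNIV)"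
    and "\<And>n. distr (P n) (count_space UNIV) (X n) = measure_pmf (pmf_of_set (D n))"
    and "prob_space M"
    and "prob_space.indep_vars M (\<lambda>_. count_space UNIV) (\<lambda>(k, p). G k p) (UNIV \<times> {p. prime p})"
    and "\<And>k p j. prime p \<Longrightarrow> measure M {\<omega> \<in> space M. G k p \<omega> \<ge> j} = 1 / real p ^ j"
  shows "(AE \<omega> in M. convergent (\<lambda>N. partial_euler_product F G N \<omega>)) \<and>
    converges_in_distribution P (\<lambda>n \<omega>. F (X n \<omega>))
      M (\<lambda>\<omega>. lim (\<lambda>N. partial_euler_product F G N \<omega>))"
proof -
  note D = assms(6-8)
  let ?e = "\<lambda>\<omega> i p. G i p \<omega>"
  have partial: "partial_euler_product F G N \<omega> = euler_part F (?e \<omega>) N" for N \<omega>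
    by (simp add: partial_euler_product_def euler_part_def)
  have budget: "summable (\<lambda>p. of_bool (prime p) * prime_budget F p)"
    by (rule summable_prime_budget[OF assms(3) assms(4,5)]) auto
  interpret M: divisibility_bounds M ?e 1
    by (rule divisibility_bounds_geometric[OF assms(1,14,15,16)])
  obtain K where K: "K > 0" "\<And>i j a b n. \<lbrakk>i \<noteq> j; a \<ge> 1; b \<ge> 1\<rbrakk> \<Longrightarrow>
      real (card (int_vec ` D n \<inter> coord_multiples i a \<inter> coord_multiples j b)) / real (card (D n))
        \<le> K / (real a * real b)"
    using assms(10) by blast
  have \<mu>: "divisibility_bounds (measure_pmf (pmf_of_set (D n))) exponents K" for n
    by (rule divisibility_bounds_uniform[OF assms(1) K(1) D K(2)])
  have conv: "AE \<omega> in M. convergent (\<lambda>N. partial_euler_product F G N \<omega>)"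
    using M.AE_summable_prime_cost[OF budget] unfolding partial
    by eventually_elim (rule euler_part_convergent[OF assms(2)])
  have X_meas: "(\<lambda>\<omega>. F (X n \<omega>)) \<in> borel_measurable (P n)" for n
    using assms(12) by (rule measurable_compose) simp
  have "(\<lambda>\<omega>. partial_euler_product F G N \<omega>) \<in> borel_measurable M" for N
    unfolding partial F_smooth_vec[OF assms(2), symmetric]
    by (rule measurable_compose[OF smooth_vec_measurable]) (auto intro: M.measurable_exponent)
  then have Y_meas: "(\<lambda>\<omega>. lim (\<lambda>N. partial_euler_product F G N \<omega>)) \<in> borel_measurable M"
    by (rule borel_measurable_lim_metric)
  have "(\<lambda>n. \<integral>\<omega>. f (F (X n \<omega>)) \<partial>P n) \<longlonglongrightarrow> (\<integral>\<omega>. f (lim (\<lambda>N. partial_euler_product F G N \<omega>)) \<partial>M)"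
    if f: "continuous_on UNIV f" "bounded (range f)" for f :: "complex \<Rightarrow> real"
  proof -
    obtain B where B: "\<And>z. \<bar>f z\<bar> \<le> B" using f(2) by (auto simp: bounded_iff)
    have law: "(\<integral>\<omega>. f (F (X n \<omega>)) \<partial>P n) = (\<integral>x. f (F x) \<partial>pmf_of_set (D n))" for n
      unfolding assms(13)[symmetric] by (rule integral_distr[symmetric, OF assms(12)]) simp
    have trunc: "(\<lambda>n. \<integral>x. h (smooth_vec (exponents x) N) \<partial>pmf_of_set (D n))
        \<longlonglongrightarrow> (\<integral>\<omega>. h (smooth_vec (?e \<omega>) N) \<partial>M)"
      if "\<And>v. \<bar>h v\<bar> \<le> C" for N C and h :: "nat ^ 'd \<Rightarrow> real"
      by (rule smooth_part_expectation_tendsto[OF D assms(9,14,15,16) that])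
    show ?thesis
      unfolding partial law
      by (rule expectation_tendsto_euler_product[OF assms(2) budget M.divisibility_bounds_axioms D \<mu> trunc f(1) B])
  qed
  then show ?thesis
    using conv X_meas Y_meas by (simp add: converges_in_distribution_def)
qed

end
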